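(* Let $\Phi_1,\Phi_2,\Phi_3$ be Young functions. (i) If $$\sup_{x>0}\frac{\Phi_1^{-1}(x)\,\Phi_2^{-1}(x)}{\Phi_3^{-1}(x)}<\infty,$$ then $\tilde{\mathcal M}_{(\Phi_1,\Phi_2,\Phi_3)}(\mathbb R)\neq\{0\}$. (ii) If $\tilde{\mathcal M}_{(\Phi_1,\Phi_2,\Phi_3)}(\mathbb R)\neq\{0\}$, then for every $a>0$ $$\sup_{N\ge 1}\frac{\Phi_1^{-1}\left(\frac1{Na}\right)\Phi_2^{-1}\left(\frac1{Na}\right)}{\Phi_3^{-1}\left(\frac1{Na}\right)}<\infty,$$ where $N$ ranges over the positive integers.
   Context: A Young function is a function $\Phi:\mathbb R\to[0,\infty]$, not identically zero, which is convex, even and satisfies $\Phi(0)=0$; it is assumed that $L^\Phi(\mathbb R)\ne\{0\}$, i.e. $\Phi(x)<\infty$ for some $x>0$. For $y\ge 0$, $\Phi^{-1}(y)=\inf\{x>0:\Phi(x)>y\}$ (with $\inf\emptyset=\infty$). The Orlicz space $L^\Phi(\mathbb R)$ consists of the measurable $f:\mathbb R\to\mathbb C$ (modulo a.e. equality) with $\int_{\mathbb R}\Phi(|f(x)|/\lambda)\,dx<\infty$ for some $\lambda>0$, with the Luxemburg norm $N_\Phi(f)=\inf\{\lambda>0:\int_{\mathbb R}\Phi(|f(x)|/\lambda)\,dx\le 1\}$. The Fourier transform is $\hat f(\xi)=\int_{\mathbb R}f(x)e^{-2\pi i x\xi}\,dx$, and $\mathcal P(\mathbb R)$ is the set of $f\in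 L^1(\mathbb R)$ such that $\operatorname{supp}\hat f$ is compact. $\tilde{\mathcal M}_{(\Phi_1,\Phi_2,\Phi_3)}(\mathbb R)$ is the space of locally integrable functions $M:\mathbb R\to\mathbb C$ (modulo a.e. equality) for which there is a constant $C>0$ such that the bilinear map $$B_M(f,g)(x)=\int_{\mathbb R}\int_{\mathbb R}\hat f(\xi)\hat g(\eta)M(\xi-\eta)e^{2\pi i(\xi+\eta)x}\,d\xi\,d\eta$$ satisfies $N_{\Phi_3}(B_M(f,g))\le C\,N_{\Phi_1}(f)N_{\Phi_2}(g)$ for all $f,g\in\mathcal P(\mathbb R)$. *)

theory Defs
  imports "HOL-Analysis.Analysis"
begin

definition young_function :: "(real \<Rightarrow> ennreal) \<Rightarrow> bool" where
  "young_function \<Phi> \<longleftrightarrow>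
     \<Phi> 0 = 0 \<and>
     (\<exists>x. \<Phi> x \<noteq> 0) \<and>
     (\<forall>x. \<Phi> (- x) = \<Phi> x) \<and>
     (\<forall>x y t. 0 \<le> t \<and> t \<le> 1 \<longrightarrow>
        \<Phi> ((1 - t) * x + t * y) \<le> ennreal (1 - t) * \<Phi> x + ennreal t * \<Phi> y) \<and>
     (\<exists>x>0. \<Phi> x < \<infinity>)"

text \<open>The generalised inverse is \<^typ>\<open>ennreal\<close>-valued, so that the infimum of the empty
  set is \<open>\<infinity>\<close>; it is only meant for arguments \<open>y \<ge> 0\<close>.\<close>

definition young_inv :: "(real \<Rightarrow> ennreal) \<Rightarrow> real \<Rightarrow> ennreal" where
  "young_inv \<Phi> y = (INF x\<in>{x. 0 < x \<and> ennreal y < \<Phi> x}. ennreal x)"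

text \<open>The Luxemburg norm as an extended number: a measurable \<open>f\<close> lies in the Orlicz space
  of \<open>\<Phi>\<close> iff \<open>luxemburg_norm \<Phi> f < \<infinity>\<close>. Functions are not identified modulo
  a.e. equality; representatives are used throughout.\<close>

definition luxemburg_norm :: "(real \<Rightarrow> ennreal) \<Rightarrow> (real \<Rightarrow> complex) \<Rightarrow> ennreal" where
  "luxemburg_norm \<Phi> f =
     (INF l\<in>{l. 0 < l \<and> (\<integral>\<^sup>+ x. \<Phi> (norm (f x) / l) \<partial>lebesgue) \<le> 1}. ennreal l)"

definition fourier :: "(real \<Rightarrow> complex) \<Rightarrow> real \<Rightarrow> complex" where
  "fourier f \<xi> = (LINT x|lebesgue. f x * exp (- 2 * of_real pi * \<i> * of_real (x * \<xi>)))"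

definition bandlimited :: "(real \<Rightarrow> complex) set" where
  "bandlimited = {f. integrable lebesgue f \<and> compact (closure {\<xi>. fourier f \<xi> \<noteq> 0})}"

definition locally_integrable :: "(real \<Rightarrow> complex) \<Rightarrow> bool" where
  "locally_integrable M \<longleftrightarrow> (\<forall>K. compact K \<longrightarrow> set_integrable lebesgue K M)"

definition bilinear_mult ::
    "(real \<Rightarrow> complex) \<Rightarrow> (real \<Rightarrow> complex) \<Rightarrow> (real \<Rightarrow> complex) \<Rightarrow> real \<Rightarrow> complex" where
  "bilinear_mult M f g x =
     (LINT \<eta>|lebesgue. LINT \<xi>|lebesgue.
        fourier f \<xi> * fourier g \<eta> * M (\<xi> - \<eta>)
          * exp (2 * of_real pi * \<i> * of_real ((\<xi> + \<eta>) * x)))"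

definition multiplier_space ::
    "(real \<Rightarrow> ennreal) \<Rightarrow> (real \<Rightarrow> ennreal) \<Rightarrow> (real \<Rightarrow> ennreal) \<Rightarrow> (real \<Rightarrow> complex) set" where
  "multiplier_space \<Phi>1 \<Phi>2 \<Phi>3 =
     {M. locally_integrable M \<and>
         (\<exists>C::real. 0 < C \<and>
            (\<forall>f\<in>bandlimited. \<forall>g\<in>bandlimited.
               luxemburg_norm \<Phi>3 (bilinear_mult M f g)
                 \<le> ennreal C * luxemburg_norm \<Phi>1 f * luxemburg_norm \<Phi>2 g))}"

text \<open>Equality of the multiplier space (which always contains 0) with \<open>{0}\<close> modulo a.e. equality, on the level of
  representatives.\<close>

definition trivial_ae :: "(real \<Rightarrow> complex) set \<Rightarrow> bool" where
  "trivial_ae S \<longleftrightarrow> (\<forall>M\<in>S. AE x in lebesgue. M x = 0)"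

end

theory Submission
  imports Defs "HOL-Probability.Levy"
begin

text \<open>Part (i) holds because the constant function \<open>1\<close> is a multiplier. By Fourier inversion the
  bilinear map attached to \<open>1\<close> is pointwise multiplication, \<open>B\<^sub>1(f, g) = f g\<close> almost everywhere
  (\<open>bilinear_mult_one\<close>), and a bound \<open>\<Phi>1\<inverse>(y) \<Phi>2\<inverse>(y) \<le> K \<Phi>3\<inverse>(y)\<close> is what O'Neil's form of
  Hoelder's inequality in Orlicz spaces needs (\<open>luxemburg_prod_le\<close>). Inversion for integrable
  functions with integrable transform is deduced from Levy's inversion formula for probability
  measures: by linearity that formula computes the integral of any integrable function over any
  interval from its transform, and Lebesgue's differentiation theorem turns equality of all
  interval integrals into equality almost everywhere (\<open>fourier_inversion\<close>).

  Part (ii) is a blow-up argument. Let \<open>M\<close> be a multiplier that is not almost everywhere zero and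
  choose a Lebesgue point \<open>\<tau>\<close> of \<open>M\<close> with \<open>m = M \<tau> \<noteq> 0\<close>. Let \<open>F\<close> be the Fejer kernel, whose
  transform is the tent function \<open>max 0 (1 - \<bar>\<xi>\<bar>)\<close>, and test \<open>M\<close> on the dilates
  \<open>f x = e\<^bsup>2\<pi>i(\<tau> + 2r)x\<^esup> F(r x)\<close> and \<open>g x = F(r x)\<close> with \<open>r \<rightarrow> 0\<close>. In \<open>B\<^sub>M(f, g)\<close> only the values of \<open>M\<close> on
  \<open>[\<tau>, \<tau> + 4r]\<close> occur, so \<open>B\<^sub>M(f, g)\<close> tends uniformly to \<open>m f g\<close> (\<open>bilinear_wave_approx\<close>); as
  \<open>\<bar>F\<bar>\<close> is at least \<open>1/2\<close> near the origin, \<open>\<bar>B\<^sub>M(f, g)\<bar>\<close> is bounded below by a constant on an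
  interval of length \<open>1 / (8 r)\<close>. This forces \<open>N\<^sub>3(B\<^sub>M(f, g))\<close> to be at least a multiple of
  \<open>1 / \<Phi>3\<inverse>(8 r)\<close> (\<open>luxemburg_ge_of_bound\<close>). Convexity and \<open>\<bar>F\<bar> \<le> 1\<close>, \<open>F \<in> L\<^sup>1\<close> show conversely that
  \<open>N\<^sub>\<Phi>(f)\<close> and \<open>N\<^sub>\<Phi>(g)\<close> are at most \<open>2 / \<Phi>\<inverse>(r / A)\<close>, where \<open>A\<close> bounds the \<open>L\<^sup>1\<close> norm of \<open>F\<close>
  (\<open>luxemburg_wave_le\<close>). Since \<open>\<Phi>\<inverse>(t y) \<le> t \<Phi>\<inverse>(y)\<close> for \<open>t \<ge> 1\<close>, the arguments \<open>8 r\<close> and \<open>r / A\<close> may be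
  replaced by a common one at the price of a constant, so the multiplier inequality gives
  \<open>\<Phi>1\<inverse>(y) \<Phi>2\<inverse>(y) \<le> K \<Phi>3\<inverse>(y)\<close> for all small \<open>y\<close>
  (\<open>yinv_bound_of_nontrivial_multiplier\<close>). For \<open>y\<close> in a compact subinterval of \<open>(0, \<infinity>)\<close>
  monotonicity of the inverses bounds the quotient.\<close>

section \<open>Young functions and their generalised inverses\<close>

text \<open>For positive arguments the generalised inverse of a Young function is positive and finite, so it
  can be handled as a real number; \<open>young_inv_eq\<close> is the translation.\<close>

definition yinv :: "(real \<Rightarrow> ennreal) \<Rightarrow> real \<Rightarrow> real" where
  "yinv \<Phi> y = enn2real (young_inv \<Phi> y)"

lemma young_zero: "young_function \<Phi> \<Longrightarrow> \<Phi> 0 = 0"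
  by (simp add: young_function_def)

lemma young_even: "young_function \<Phi> \<Longrightarrow> \<Phi> (- x) = \<Phi> x"
  unfolding young_function_def by blast

lemma young_scale:
  assumes "young_function \<Phi>" "0 \<le> t" "t \<le> 1"
  shows "\<Phi> (t * x) \<le> ennreal t * \<Phi> x"
proof -
  have "\<Phi> ((1 - t) * 0 + t * x) \<le> ennreal (1 - t) * \<Phi> 0 + ennreal t * \<Phi> x"
    using assms unfolding young_function_def by blast
  then show ?thesis
    using young_zero[OF assms(1)] by simp
qed

lemma young_mono:
  assumes "young_function \<Phi>" "0 \<le> x" "x \<le> y"
  shows "\<Phi> x \<le> \<Phi> y"
proof (cases "y = 0")
  case False
  have "\<Phi> (x / y * y) \<le> ennreal (x / y) * \<Phi> y"
    using assms False by (intro young_scale) auto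
  also have "\<dots> \<le> 1 * \<Phi> y"
    using assms False by (intro mult_right_mono) (auto simp: ennreal_le_1)
  finally show ?thesis using False by simp
qed (use assms in auto)

text \<open>Convexity gives \<open>\<Phi> x \<le> \<Phi>(n x) / n\<close>, so a bound for \<open>\<Phi>\<close> would force \<open>\<Phi> = 0\<close>.\<close>

lemma young_unbounded:
  assumes "young_function \<Phi>"
  obtains x where "0 < x" "ennreal y < \<Phi> x"
proof -
  obtain x0 where x0: "\<Phi> x0 \<noteq> 0" using assms by (auto simp: young_function_def)
  define x where "x = \<bar>x0\<bar>"
  have x: "\<Phi> x \<noteq> 0" "0 < x"
  proof -
    have "x0 \<noteq> 0" using x0 young_zero[OF assms] by auto
    then show "\<Phi> x \<noteq> 0" "0 < x"
      using x0 young_even[OF assms, of x0] by (auto simp: x_def abs_if)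
  qed
  have "\<exists>n. \<not> \<Phi> (real (Suc n) * x) \<le> ennreal y"
  proof (rule ccontr)
    assume "\<not> ?thesis"
    then have *: "\<Phi> (real (Suc n) * x) \<le> ennreal y" for n by blast
    have "\<Phi> x \<le> ennreal (max y 0 / real (Suc n))" for n
    proof -
      have "\<Phi> (1 / real (Suc n) * (real (Suc n) * x)) \<le> ennreal (1 / real (Suc n)) * \<Phi> (real (Suc n) * x)"
        using assms by (intro young_scale) auto
      also have "\<dots> \<le> ennreal (1 / real (Suc n)) * ennreal (max y 0)"
        using order_trans[OF *[of n] ennreal_leI[of y "max y 0"]] by (intro mult_left_mono) auto
      also have "\<dots> = ennreal (max y 0 / real (Suc n))"
        by (subst ennreal_mult[symmetric]) auto
      finally show ?thesis by (simp del: of_nat_Suc)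
    qed
    moreover have "(\<lambda>n. ennreal (max y 0 / real (Suc n))) \<longlonglongrightarrow> ennreal 0"
      by (intro tendsto_ennrealI LIMSEQ_Suc lim_const_over_n)
    ultimately have "\<Phi> x \<le> ennreal 0"
      by (meson LIMSEQ_le_const)
    with x show False by simp
  qed
  then obtain n where "ennreal y < \<Phi> (real (Suc n) * x)" by (auto simp: not_le)
  with x that[of "real (Suc n) * x"] show ?thesis by simp
qed

lemma young_inv_eq:
  assumes "young_function \<Phi>"
  shows "young_inv \<Phi> y = ennreal (yinv \<Phi> y)"
proof -
  obtain x where "0 < x" "ennreal y < \<Phi> x" using young_unbounded[OF assms] .
  then have "young_inv \<Phi> y \<le> ennreal x"
    unfolding young_inv_def by (intro INF_lower) auto
  then show ?thesis unfolding yinv_def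
    by (metis ennreal_enn2real ennreal_less_top order_le_less_trans)
qed

lemma yinv_nonneg [simp]: "0 \<le> yinv \<Phi> y"
  by (simp add: yinv_def)

text \<open>Together with its companion \<open>le_of_less_yinv\<close> this says that \<open>yinv \<Phi> y\<close> is the supremum of the
  sublevel set \<open>\<Phi> \<le> y\<close>. The companion needs a strict inequality because \<open>\<Phi>\<close> may jump, even to
  \<open>\<infinity>\<close>, at the supremum; this is where the factors of two in the norm estimates come from.\<close>

lemma le_yinvI:
  assumes "young_function \<Phi>" "\<Phi> x \<le> ennreal y"
  shows "x \<le> yinv \<Phi> y"
proof (cases "0 \<le> x")
  case True
  have "ennreal x \<le> young_inv \<Phi> y"
    unfolding young_inv_def
  proof (rule INF_greatest, clarify)
    fix z :: real assume "0 < z" "ennreal y < \<Phi> z"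
    then have "\<not> z \<le> x"
      using young_mono[OF assms(1), of z x] assms(2) by auto
    then show "ennreal x \<le> ennreal z" by (intro ennreal_leI) auto
  qed
  then show ?thesis
    unfolding young_inv_eq[OF assms(1)] by (simp add: ennreal_le_iff)
qed (use yinv_nonneg[of \<Phi> y] in linarith)

lemma le_of_less_yinv:
  assumes "young_function \<Phi>" "0 \<le> x" "x < yinv \<Phi> y"
  shows "\<Phi> x \<le> ennreal y"
proof (rule ccontr)
  assume *: "\<not> ?thesis"
  then have "x \<noteq> 0" using young_zero[OF assms(1)] by auto
  then have "young_inv \<Phi> y \<le> ennreal x"
    unfolding young_inv_def using * assms by (intro INF_lower) auto
  then show False
    using assms unfolding young_inv_eq[OF assms(1)] by (simp add: ennreal_le_iff)
qed

lemma yinv_pos: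
  assumes "young_function \<Phi>" "0 < y"
  shows "0 < yinv \<Phi> y"
proof -
  obtain x where x: "0 < x" "\<Phi> x < \<infinity>" using assms by (auto simp: young_function_def)
  define c where "c = enn2real (\<Phi> x)"
  have c: "\<Phi> x = ennreal c" "0 \<le> c" using x by (auto simp: c_def)
  define t where "t = min 1 (y / (c + 1))"
  have t: "0 < t" "t \<le> 1" using assms c by (auto simp: t_def)
  have "t * c \<le> y / (c + 1) * c" using c by (intro mult_right_mono) (auto simp: t_def)
  also have "\<dots> \<le> y" using c assms by (simp add: field_simps)
  finally have tc: "t * c \<le> y" .
  have "\<Phi> (t * x) \<le> ennreal t * \<Phi> x" using assms t by (intro young_scale) auto
  also have "\<dots> = ennreal (t * c)" using c t by (simp add: ennreal_mult)
  also have "\<dots> \<le> ennreal y" using tc by (rule ennreal_leI)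
  finally have "t * x \<le> yinv \<Phi> y" by (rule le_yinvI[OF assms(1)])
  with t x show ?thesis by (meson mult_pos_pos order_less_le_trans)
qed

lemma yinv_mono:
  assumes "young_function \<Phi>" "y \<le> z"
  shows "yinv \<Phi> y \<le> yinv \<Phi> z"
proof (rule dense_le)
  fix x assume x: "x < yinv \<Phi> y"
  show "x \<le> yinv \<Phi> z"
  proof (cases "0 \<le> x")
    case True
    then have "\<Phi> x \<le> ennreal y" using le_of_less_yinv[OF assms(1) _ x] by simp
    also have "\<dots> \<le> ennreal z" using assms(2) by (rule ennreal_leI)
    finally show ?thesis by (rule le_yinvI[OF assms(1)])
  qed (use yinv_nonneg[of \<Phi> z] in linarith)
qed

text \<open>The inverse of a convex function that vanishes at the origin grows at most linearly. This is why
  the constants appearing in the arguments of the inverses are harmless.\<close>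

lemma yinv_scale:
  assumes "young_function \<Phi>" "1 \<le> t" "0 \<le> y"
  shows "yinv \<Phi> (t * y) \<le> t * yinv \<Phi> y"
proof (rule dense_le)
  fix x assume x: "x < yinv \<Phi> (t * y)"
  show "x \<le> t * yinv \<Phi> y"
  proof (cases "0 \<le> x")
    case True
    then have "\<Phi> (1 / t * x) \<le> ennreal (1 / t) * \<Phi> x"
      using assms by (intro young_scale) auto
    also have "\<dots> \<le> ennreal (1 / t) * ennreal (t * y)"
      using le_of_less_yinv[OF assms(1) True x] by (intro mult_left_mono) auto
    also have "\<dots> = ennreal y"
      using assms by (subst ennreal_mult[symmetric]) auto
    finally have "1 / t * x \<le> yinv \<Phi> y" by (rule le_yinvI[OF assms(1)])
    then show ?thesis using assms by (simp add: field_simps)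
  qed (use assms mult_nonneg_nonneg[of t "yinv \<Phi> y"] yinv_nonneg[of \<Phi> y] in linarith)
qed

text \<open>A Young function is even and monotone on the positive half line, so the sets \<open>\<Phi> > c\<close> are, after
  composition with the absolute value, preimages of intervals.\<close>

lemma young_measurable:
  assumes "young_function \<Phi>"
  shows "\<Phi> \<in> borel_measurable borel"
proof -
  have "(\<lambda>x. \<Phi> (max 0 x)) \<in> borel_measurable borel"
  proof (rule borel_measurableI_greater)
    fix c
    have "is_interval {x. c < \<Phi> (max 0 x)}"
      unfolding is_interval_1
    proof clarify
      fix u v x :: real assume "c < \<Phi> (max 0 u)" "u \<le> x"
      then show "c < \<Phi> (max 0 x)"
        using young_mono[OF assms, of "max 0 u" "max 0 x"] by (auto intro: less_le_trans)
    qed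
    then show "{x \<in> space borel. c < \<Phi> (max 0 x)} \<in> sets borel"
      by (simp add: real_interval_borel_measurable)
  qed
  then have "(\<lambda>x. \<Phi> (max 0 \<bar>x\<bar>)) \<in> borel_measurable borel"
    by measurable
  moreover have "\<Phi> (max 0 \<bar>x\<bar>) = \<Phi> x" for x
    using young_even[OF assms] by (simp add: abs_if)
  ultimately show ?thesis by simp
qed

lemma young_inv_ratio:
  assumes \<Phi>: "young_function \<Phi>1" "young_function \<Phi>2" "young_function \<Phi>3" and y: "0 < y"
  shows "young_inv \<Phi>1 y * young_inv \<Phi>2 y / young_inv \<Phi>3 y = ennreal (yinv \<Phi>1 y * yinv \<Phi>2 y / yinv \<Phi>3 y)"
  using yinv_pos[OF \<Phi>(3) y] by (simp add: young_inv_eq[OF \<Phi>(1)] young_inv_eq[OF \<Phi>(2)] young_inv_eq[OF \<Phi>(3)] divide_ennreal flip: ennreal_mult)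

section \<open>The Luxemburg norm\<close>

lemma luxemburg_leI:
  assumes "0 < l" "(\<integral>\<^sup>+ x. \<Phi> (norm (f x) / l) \<partial>lebesgue) \<le> 1"
  shows "luxemburg_norm \<Phi> f \<le> ennreal l"
  unfolding luxemburg_norm_def using assms by (intro INF_lower) auto

lemma luxemburg_geI:
  assumes "\<And>l. 0 < l \<Longrightarrow> (\<integral>\<^sup>+ x. \<Phi> (norm (f x) / l) \<partial>lebesgue) \<le> 1 \<Longrightarrow> c \<le> ennreal l"
  shows "c \<le> luxemburg_norm \<Phi> f"
  unfolding luxemburg_norm_def using assms by (intro INF_greatest) auto

lemma luxemburg_cong_AE:
  assumes "AE x in lebesgue. f x = g x"
  shows "luxemburg_norm \<Phi> f = luxemburg_norm \<Phi> g"
proof -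
  have "(\<integral>\<^sup>+ x. \<Phi> (norm (f x) / l) \<partial>lebesgue) = (\<integral>\<^sup>+ x. \<Phi> (norm (g x) / l) \<partial>lebesgue)" for l
    using assms by (intro nn_integral_cong_AE) auto
  then show ?thesis by (simp add: luxemburg_norm_def)
qed

lemma luxemburg_zero:
  assumes "young_function \<Phi>"
  shows "luxemburg_norm \<Phi> (\<lambda>x. 0) = 0"
proof -
  have "luxemburg_norm \<Phi> (\<lambda>x. 0) \<le> 0 + ennreal e" if "0 < e" for e
    using luxemburg_leI[OF that, of \<Phi> "\<lambda>x. 0"] young_zero[OF assms] by simp
  then have "luxemburg_norm \<Phi> (\<lambda>x. 0) \<le> 0"
    by (rule ennreal_le_epsilon)
  then show ?thesis by simp
qed

text \<open>Needed because \<open>0 \<cdot> \<infinity> = 0\<close> in the extended reals: a product bound of norms must also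
  hold when one norm is zero and the other one infinite. If \<open>\<bar>f\<bar> \<ge> 1/n\<close> held on a set of measure at
  least \<open>\<delta> > 0\<close>, then \<open>\<Phi>(1 / (n l)) \<delta> \<le> 1\<close> for every admissible \<open>l\<close>, and as \<open>\<Phi>\<close> is unbounded this
  keeps \<open>l\<close> away from zero.\<close>

lemma luxemburg_eq_0D:
  assumes \<Phi>: "young_function \<Phi>" and f [measurable]: "f \<in> borel_measurable lebesgue"
    and zero: "luxemburg_norm \<Phi> f = 0"
  shows "AE x in lebesgue. f x = 0"
proof -
  have null: "emeasure lebesgue {x\<in>space lebesgue. 1 / real (Suc n) \<le> norm (f x)} = 0" (is "emeasure lebesgue ?E = 0") for n
  proof (rule ccontr)
    assume "emeasure lebesgue ?E \<noteq> 0"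
    then have "0 < emeasure lebesgue ?E" by (simp add: zero_less_iff_neq_zero)
    then obtain d where d: "0 < d" "d < emeasure lebesgue ?E" using dense by blast
    \<comment> \<open>the measure of the set may be infinite, so a finite \<open>\<delta>\<close> strictly below it is used\<close>
    define \<delta> where "\<delta> = enn2real d"
    have "d \<noteq> \<infinity>" using d by auto
    then have "d = ennreal \<delta>" by (simp add: \<delta>_def less_top)
    with d have \<delta>: "0 < \<delta>" "ennreal \<delta> < emeasure lebesgue ?E" by auto
    obtain z where z: "0 < z" "ennreal (1 / \<delta>) < \<Phi> z" using young_unbounded[OF \<Phi>] .
    have "ennreal (1 / (real (Suc n) * z)) \<le> luxemburg_norm \<Phi> f"
    proof (rule luxemburg_geI, rule ccontr)
      fix l :: real assume l: "0 < l" and le: "(\<integral>\<^sup>+ x. \<Phi> (norm (f x) / l) \<partial>lebesgue) \<le> 1"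
        and less: "\<not> ennreal (1 / (real (Suc n) * z)) \<le> ennreal l"
      have "l < 1 / (real (Suc n) * z)"
        using less l by (meson ennreal_leI linorder_not_le)
      then have zl: "z \<le> 1 / real (Suc n) / l"
        using l z by (simp add: pos_le_divide_eq pos_less_divide_eq mult_ac del: of_nat_Suc)
      have "ennreal (1 / \<delta>) * emeasure lebesgue ?E = (\<integral>\<^sup>+ x. ennreal (1 / \<delta>) * indicator ?E x \<partial>lebesgue)"
        by (subst nn_integral_cmult_indicator) measurable
      also have "\<dots> \<le> (\<integral>\<^sup>+ x. \<Phi> (norm (f x) / l) \<partial>lebesgue)"
      proof (rule nn_integral_mono)
        fix x
        show "ennreal (1 / \<delta>) * indicator ?E x \<le> \<Phi> (norm (f x) / l)"
        proof (cases "x \<in> ?E")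
          case True
          then have "1 / real (Suc n) / l \<le> norm (f x) / l"
            using l by (intro divide_right_mono) auto
          then have "\<Phi> z \<le> \<Phi> (norm (f x) / l)"
            using zl z by (intro young_mono[OF \<Phi>]) auto
          then show ?thesis using z True by (auto simp: indicator_def)
        qed simp
      qed
      finally have "ennreal (1 / \<delta>) * emeasure lebesgue ?E \<le> 1" using le by auto
      moreover have "ennreal (1 / \<delta>) * ennreal \<delta> < ennreal (1 / \<delta>) * emeasure lebesgue ?E"
        using \<delta> by (intro ennreal_mult_strict_left_mono) auto
      moreover have "ennreal (1 / \<delta>) * ennreal \<delta> = 1"
        using \<delta> by (subst ennreal_mult[symmetric]) auto
      ultimately show False by (metis leD)
    qed
    then show False using zero z by simp
  qed
  have sets: "?E n \<in> sets lebesgue" for n by measurable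
  have "AE x in lebesgue. \<not> 1 / real (Suc n) \<le> norm (f x)" for n
    using null[of n] by (intro AE_I'[of "?E n"]) (use sets[of n] in \<open>auto simp: null_sets_def simp del: of_nat_Suc\<close>)
  then have "AE x in lebesgue. \<forall>n. \<not> 1 / real (Suc n) \<le> norm (f x)"
    by (simp add: AE_all_countable)
  then show ?thesis
  proof (rule AE_mp, intro AE_I2 impI)
    fix x assume *: "\<forall>n. \<not> 1 / real (Suc n) \<le> norm (f x)"
    show "f x = 0"
    proof (rule ccontr)
      assume "f x \<noteq> 0"
      then obtain n where "inverse (real (Suc n)) < norm (f x)"
        using reals_Archimedean[of "norm (f x)"] by auto
      with * show False by (metis inverse_eq_divide less_imp_le)
    qed
  qed
qed

text \<open>The pointwise inequality behind Hoelder's inequality. Take \<open>y\<close> slightly above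
  \<open>\<Phi>1 u + \<Phi>2 v\<close>; then \<open>u \<le> \<Phi>1\<inverse>(y)\<close> and \<open>v \<le> \<Phi>2\<inverse>(y)\<close>, hence \<open>u v \<le> K \<Phi>3\<inverse>(y)\<close>, and the factor
  \<open>2\<close> makes the last inequality strict, so that \<open>\<Phi>3\<close> of the quotient is at most \<open>y\<close>. The extra
  \<open>e\<close> keeps \<open>y\<close> positive when both terms vanish.\<close>

lemma young_prod_le:
  assumes \<Phi>: "young_function \<Phi>1" "young_function \<Phi>2" "young_function \<Phi>3"
    and K: "0 < K" "\<And>y. 0 < y \<Longrightarrow> yinv \<Phi>1 y * yinv \<Phi>2 y \<le> K * yinv \<Phi>3 y"
    and uv: "0 \<le> u" "0 \<le> v"
  shows "\<Phi>3 (u * v / (2 * K)) \<le> \<Phi>1 u + \<Phi>2 v"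
proof (rule ennreal_le_epsilon)
  fix e :: real assume fin: "\<Phi>1 u + \<Phi>2 v < top" and e: "0 < e"
  define y where "y = enn2real (\<Phi>1 u + \<Phi>2 v) + e"
  have y: "0 < y" using e by (simp add: y_def add_nonneg_pos)
  have sum: "ennreal y = \<Phi>1 u + \<Phi>2 v + ennreal e"
    using fin e by (simp add: y_def ennreal_plus)
  have "\<Phi>1 u \<le> ennreal y" "\<Phi>2 v \<le> ennreal y"
    unfolding sum by (auto simp: add.assoc intro: add_increasing2 add_increasing)
  then have "u \<le> yinv \<Phi>1 y" "v \<le> yinv \<Phi>2 y" using \<Phi> by (auto intro: le_yinvI)
  then have "u * v \<le> yinv \<Phi>1 y * yinv \<Phi>2 y" using uv by (intro mult_mono) auto
  also have "\<dots> \<le> K * yinv \<Phi>3 y" using K y by simp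
  also have "\<dots> < 2 * K * yinv \<Phi>3 y" using K yinv_pos[OF \<Phi>(3) y] by simp
  finally have "u * v / (2 * K) < yinv \<Phi>3 y" using K by (simp add: field_simps)
  then show "\<Phi>3 (u * v / (2 * K)) \<le> \<Phi>1 u + \<Phi>2 v + ennreal e"
    unfolding sum[symmetric] using K uv by (intro le_of_less_yinv[OF \<Phi>(3)]) auto
qed

lemma luxemburg_less_obtain:
  assumes "luxemburg_norm \<Phi> f < c"
  obtains l where "0 < l" "(\<integral>\<^sup>+ x. \<Phi> (norm (f x) / l) \<partial>lebesgue) \<le> 1" "ennreal l < c"
  using assms unfolding luxemburg_norm_def INF_less_iff by auto

text \<open>O'Neil's Hoelder inequality. After normalising \<open>f\<close> and \<open>g\<close>, integrating
  \<open>young_prod_le\<close> gives the bound \<open>2\<close>; halving the argument once more brings it down to \<open>1\<close>, whence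
  the constant \<open>4 K\<close>.\<close>

lemma luxemburg_prod_le:
  assumes \<Phi>: "young_function \<Phi>1" "young_function \<Phi>2" "young_function \<Phi>3"
    and K: "0 < K" "\<And>y. 0 < y \<Longrightarrow> yinv \<Phi>1 y * yinv \<Phi>2 y \<le> K * yinv \<Phi>3 y"
    and meas [measurable]: "f \<in> borel_measurable lebesgue" "g \<in> borel_measurable lebesgue"
  shows "luxemburg_norm \<Phi>3 (\<lambda>x. f x * g x)
           \<le> ennreal (4 * K) * luxemburg_norm \<Phi>1 f * luxemburg_norm \<Phi>2 g"
proof (cases "luxemburg_norm \<Phi>1 f = 0 \<or> luxemburg_norm \<Phi>2 g = 0")
  case True
  then have "(AE x in lebesgue. f x = 0) \<or> (AE x in lebesgue. g x = 0)"
    using luxemburg_eq_0D \<Phi> meas by blast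
  then have "AE x in lebesgue. f x * g x = 0" by auto
  then have "luxemburg_norm \<Phi>3 (\<lambda>x. f x * g x) = luxemburg_norm \<Phi>3 (\<lambda>x. 0)"
    by (rule luxemburg_cong_AE)
  then show ?thesis using luxemburg_zero[OF \<Phi>(3)] by simp
next
  case False
  show ?thesis
  proof (cases "luxemburg_norm \<Phi>1 f = \<infinity> \<or> luxemburg_norm \<Phi>2 g = \<infinity>")
    case True
    then have "ennreal (4 * K) * luxemburg_norm \<Phi>1 f * luxemburg_norm \<Phi>2 g = \<infinity>"
      using False K by (auto simp: ennreal_mult_eq_top_iff)
    then show ?thesis by simp
  next
    case fin: False
    define n1 n2 where "n1 = enn2real (luxemburg_norm \<Phi>1 f)" and "n2 = enn2real (luxemburg_norm \<Phi>2 g)"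
    have n: "luxemburg_norm \<Phi>1 f = ennreal n1" "luxemburg_norm \<Phi>2 g = ennreal n2" "0 \<le> n1" "0 \<le> n2"
      using fin by (auto simp: n1_def n2_def less_top)
    have step: "luxemburg_norm \<Phi>3 (\<lambda>x. f x * g x) \<le> ennreal (4 * K * (n1 + e) * (n2 + e))" if e: "0 < e" for e
    proof -
      obtain l1 where l1: "0 < l1" "(\<integral>\<^sup>+ x. \<Phi>1 (norm (f x) / l1) \<partial>lebesgue) \<le> 1" "l1 < n1 + e"
        using luxemburg_less_obtain[of \<Phi>1 f "ennreal (n1 + e)"] n e
        by (metis ennreal_less_iff less_add_same_cancel1 less_imp_le)
      obtain l2 where l2: "0 < l2" "(\<integral>\<^sup>+ x. \<Phi>2 (norm (g x) / l2) \<partial>lebesgue) \<le> 1" "l2 < n2 + e"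
        using luxemburg_less_obtain[of \<Phi>2 g "ennreal (n2 + e)"] n e
        by (metis ennreal_less_iff less_add_same_cancel1 less_imp_le)
      note [measurable] = young_measurable[OF \<Phi>(1)] young_measurable[OF \<Phi>(2)]
      have "(\<integral>\<^sup>+ x. \<Phi>3 (norm (f x * g x) / (4 * K * l1 * l2)) \<partial>lebesgue)
          \<le> (\<integral>\<^sup>+ x. ennreal (1/2) * (\<Phi>1 (norm (f x) / l1) + \<Phi>2 (norm (g x) / l2)) \<partial>lebesgue)"
      proof (rule nn_integral_mono)
        fix x
        have "\<Phi>3 (norm (f x * g x) / (4 * K * l1 * l2))
            = \<Phi>3 (1/2 * ((norm (f x) / l1) * (norm (g x) / l2) / (2 * K)))"
          by (simp add: norm_mult mult_ac)
        also have "\<dots> \<le> ennreal (1/2) * \<Phi>3 ((norm (f x) / l1) * (norm (g x) / l2) / (2 * K))"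
          using \<Phi> by (intro young_scale) auto
        also have "\<dots> \<le> ennreal (1/2) * (\<Phi>1 (norm (f x) / l1) + \<Phi>2 (norm (g x) / l2))"
          using l1 l2 by (intro mult_left_mono young_prod_le[OF \<Phi> K]) auto
        finally show "\<Phi>3 (norm (f x * g x) / (4 * K * l1 * l2))
          \<le> ennreal (1/2) * (\<Phi>1 (norm (f x) / l1) + \<Phi>2 (norm (g x) / l2))" .
      qed
      also have "\<dots> = ennreal (1/2) * ((\<integral>\<^sup>+ x. \<Phi>1 (norm (f x) / l1) \<partial>lebesgue) + (\<integral>\<^sup>+ x. \<Phi>2 (norm (g x) / l2) \<partial>lebesgue))"
        by (subst nn_integral_cmult; (subst nn_integral_add)?; measurable)
      also have "\<dots> \<le> ennreal (1/2) * (1 + 1)"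
        using l1 l2 by (intro mult_left_mono add_mono) auto
      also have "\<dots> = ennreal (1/2) * ennreal 2" by simp
      also have "\<dots> = 1" by (subst ennreal_mult[symmetric]) auto
      finally have "luxemburg_norm \<Phi>3 (\<lambda>x. f x * g x) \<le> ennreal (4 * K * l1 * l2)"
        using K l1 l2 by (intro luxemburg_leI) auto
      also have "\<dots> \<le> ennreal (4 * K * (n1 + e) * (n2 + e))"
        using K l1 l2 n by (intro ennreal_leI mult_mono) auto
      finally show ?thesis .
    qed
    have "((\<lambda>e. ennreal (4 * K * (n1 + e) * (n2 + e))) \<longlongrightarrow> ennreal (4 * K * (n1 + 0) * (n2 + 0))) (at_right 0)"
      by (intro tendsto_ennrealI tendsto_intros)
    moreover have "\<forall>\<^sub>F e in at_right 0. luxemburg_norm \<Phi>3 (\<lambda>x. f x * g x) \<le> ennreal (4 * K * (n1 + e) * (n2 + e))"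
      using step by (auto simp: eventually_at_filter)
    ultimately have "luxemburg_norm \<Phi>3 (\<lambda>x. f x * g x) \<le> ennreal (4 * K * (n1 + 0) * (n2 + 0))"
      by (intro tendsto_lowerbound) auto
    then show ?thesis using n K by (simp add: ennreal_mult)
  qed
qed

text \<open>The norm of \<open>F\<close> dominates that of \<open>c\<close> times the indicator of \<open>[-d, d]\<close>, and the norm of the
  indicator of a set of measure \<open>s\<close> is \<open>1 / \<Phi>\<inverse>(1 / s)\<close>.\<close>

lemma luxemburg_ge_of_bound:
  assumes \<Phi>: "young_function \<Phi>" and c: "0 < c" and d: "0 < d"
    and F: "\<And>x. \<bar>x\<bar> \<le> d \<Longrightarrow> c \<le> norm (F x)"
  shows "ennreal (c / yinv \<Phi> (1 / (2 * d))) \<le> luxemburg_norm \<Phi> F"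
proof (rule luxemburg_geI)
  fix l :: real assume l: "0 < l" and le: "(\<integral>\<^sup>+ x. \<Phi> (norm (F x) / l) \<partial>lebesgue) \<le> 1"
  have "\<Phi> (c / l) * ennreal (2 * d) = (\<integral>\<^sup>+ x. \<Phi> (c / l) * indicator {-d..d} x \<partial>lebesgue)"
    using d by (subst nn_integral_cmult_indicator) auto
  also have "\<dots> \<le> (\<integral>\<^sup>+ x. \<Phi> (norm (F x) / l) \<partial>lebesgue)"
  proof (rule nn_integral_mono)
    fix x
    show "\<Phi> (c / l) * indicator {-d..d} x \<le> \<Phi> (norm (F x) / l)"
      using F[of x] c l by (auto simp: indicator_def abs_le_iff intro!: young_mono[OF \<Phi>] divide_right_mono)
  qed
  finally have "\<Phi> (c / l) * ennreal (2 * d) \<le> 1" using le by simp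
  then have "\<Phi> (c / l) * ennreal (2 * d) * ennreal (1 / (2 * d)) \<le> 1 * ennreal (1 / (2 * d))"
    by (rule mult_right_mono) simp
  moreover have "ennreal (2 * d) * ennreal (1 / (2 * d)) = 1"
    using d by (subst ennreal_mult[symmetric]) auto
  ultimately have "\<Phi> (c / l) \<le> ennreal (1 / (2 * d))" by (simp add: mult.assoc)
  then have "c / l \<le> yinv \<Phi> (1 / (2 * d))" by (rule le_yinvI[OF \<Phi>])
  then show "ennreal (c / yinv \<Phi> (1 / (2 * d))) \<le> ennreal l"
    using l yinv_pos[OF \<Phi>, of "1 / (2 * d)"] d by (intro ennreal_leI) (simp add: field_simps)
qed

section \<open>Lebesgue differentiation on the line\<close>

text \<open>The Lebesgue form of the differentiation theorem for indefinite gauge integrals. One-sided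
  averages suffice here, since the test functions can be shifted in frequency so that they see the
  multiplier on one side of a point only.\<close>

lemma AE_right_derivative_of_integral:
  fixes g :: "real \<Rightarrow> 'b::euclidean_space"
  assumes "\<And>a b. set_integrable lborel {a..b} g"
  shows "AE x in lborel. ((\<lambda>h. (LINT t:{x..x+h}|lborel. g t) /\<^sub>R h) \<longlongrightarrow> g x) (at_right 0)"
proof -
  have "g integrable_on cbox a b" for a b
    using set_borel_integral_eq_integral(1)[OF assms] by simp
  then obtain N where N: "negligible N"
    and lim: "\<And>x e. \<lbrakk>x \<notin> N; 0 < e\<rbrakk> \<Longrightarrow> \<exists>d>0. \<forall>h. 0 < h \<and> h < d \<longrightarrow>
                norm (integral (cbox x (x + h *\<^sub>R One)) g /\<^sub>R h ^ DIM(real) - g x) < e"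
    using integrable_ccontinuous_explicit[of g] by blast
  have lim': "((\<lambda>h. (LINT t:{x..x+h}|lborel. g t) /\<^sub>R h) \<longlongrightarrow> g x) (at_right 0)" if x: "x \<notin> N" for x
  proof (rule tendstoI)
    fix e :: real assume "0 < e"
    then obtain d where d: "0 < d" "\<And>h. 0 < h \<Longrightarrow> h < d \<Longrightarrow> norm (integral {x..x+h} g /\<^sub>R h - g x) < e"
      using lim[OF x, of e] by auto
    then show "\<forall>\<^sub>F h in at_right 0. dist ((LINT t:{x..x+h}|lborel. g t) /\<^sub>R h) (g x) < e"
      unfolding eventually_at_right_field set_borel_integral_eq_integral(2)[OF assms] dist_norm
      by blast
  qed
  have "AE x in lebesgue. x \<notin> N"
    using N by (intro AE_not_in) (simp add: negligible_iff_null_sets)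
  then have "AE x in lborel. x \<notin> N"
    by (simp only: AE_completion_iff)
  then show ?thesis
    by eventually_elim (rule lim')
qed

lemma AE_eq_0_of_interval_integrals:
  fixes g :: "real \<Rightarrow> 'b::euclidean_space"
  assumes "\<And>a b. set_integrable lborel {a..b} g" "\<And>a b. a \<le> b \<Longrightarrow> (LINT t:{a..b}|lborel. g t) = 0"
  shows "AE x in lborel. g x = 0"
  using AE_right_derivative_of_integral[OF assms(1)]
proof (rule AE_mp, intro AE_I2 impI)
  fix x assume lim: "((\<lambda>h. (LINT t:{x..x+h}|lborel. g t) /\<^sub>R h) \<longlongrightarrow> g x) (at_right 0)"
  have "\<forall>\<^sub>F h in at_right 0. (LINT t:{x..x+h}|lborel. g t) /\<^sub>R h = 0"
    unfolding eventually_at_right_field using assms(2) by (intro exI[of _ 1]) auto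
  from tendsto_unique[OF _ lim tendsto_eventually[OF this]] show "g x = 0"
    by simp
qed

text \<open>For each fixed \<open>q\<close> the averages of \<open>\<bar>g - q\<bar>\<close> converge almost everywhere; off a null set this holds
  for all \<open>q\<close> in a countable dense set, and choosing \<open>q\<close> close to \<open>g x\<close> gives the claim.\<close>

lemma AE_right_Lebesgue_point:
  fixes g :: "real \<Rightarrow> complex"
  assumes g: "\<And>a b. set_integrable lborel {a..b} g"
  shows "AE x in lborel. ((\<lambda>h. (LINT t:{x..x+h}|lborel. norm (g t - g x)) / h) \<longlongrightarrow> 0) (at_right 0)"
proof -
  obtain Q :: "complex set" where Q: "countable Q" "\<And>U. open U \<Longrightarrow> U \<noteq> {} \<Longrightarrow> \<exists>q\<in>Q. q \<in> U"
    using countable_dense_exists by blast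
  have const: "set_integrable lborel {a..b} (\<lambda>t. c :: complex)" for a b :: real and c
    by (intro borel_integrable_atLeastAtMost') auto
  have int: "set_integrable lborel {a..b} (\<lambda>t. norm (g t - q))" for a b q
    by (intro set_integrable_norm set_integral_diff(1) g const)
  have "AE x in lborel. \<forall>q\<in>Q. ((\<lambda>h. (LINT t:{x..x+h}|lborel. norm (g t - q)) /\<^sub>R h) \<longlongrightarrow> norm (g x - q)) (at_right 0)"
    unfolding AE_ball_countable[OF Q(1)]
    using AE_right_derivative_of_integral[OF int] by blast
  then show ?thesis
  proof (rule AE_mp, intro AE_I2 impI)
    fix x
    assume lim: "\<forall>q\<in>Q. ((\<lambda>h. (LINT t:{x..x+h}|lborel. norm (g t - q)) /\<^sub>R h) \<longlongrightarrow> norm (g x - q)) (at_right 0)"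
    show "((\<lambda>h. (LINT t:{x..x+h}|lborel. norm (g t - g x)) / h) \<longlongrightarrow> 0) (at_right 0)"
    proof (rule tendstoI)
      fix e :: real assume e: "0 < e"
      obtain q where q: "q \<in> Q" "norm (g x - q) < e / 3"
        using Q(2)[of "ball (g x) (e/3)"] e by (auto simp: dist_norm)
      have "\<forall>\<^sub>F h in at_right 0. dist ((LINT t:{x..x+h}|lborel. norm (g t - q)) /\<^sub>R h) (norm (g x - q)) < e / 3"
        using lim q(1) e by (intro tendstoD) auto
      moreover have "\<forall>\<^sub>F h::real in at_right 0. 0 < h" by (simp add: eventually_at_filter)
      ultimately show "\<forall>\<^sub>F h in at_right 0. dist ((LINT t:{x..x+h}|lborel. norm (g t - g x)) / h) 0 < e"
      proof eventually_elim
        case (elim h)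
        have "(LINT t:{x..x+h}|lborel. norm (g t - g x))
            \<le> (LINT t:{x..x+h}|lborel. norm (g t - q) + norm (g x - q))"
        proof (intro set_integral_mono int set_integral_add(1) set_integrable_norm[OF const])
          show "norm (g t - g x) \<le> norm (g t - q) + norm (g x - q)" for t
            using norm_triangle_ineq4[of "g t - q" "g x - q"] by simp
        qed
        also have "\<dots> = (LINT t:{x..x+h}|lborel. norm (g t - q)) + h * norm (g x - q)"
          using elim by (subst set_integral_add(2)[OF int set_integrable_norm[OF const]])
            (simp add: set_lebesgue_integral_def)
        finally have "(LINT t:{x..x+h}|lborel. norm (g t - g x)) / h
            \<le> (LINT t:{x..x+h}|lborel. norm (g t - q)) / h + norm (g x - q)"
          using elim by (simp add: field_simps)
        also have "\<dots> < e"
        proof -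
          have "\<bar>(LINT t:{x..x+h}|lborel. norm (g t - q)) / h - norm (g x - q)\<bar> < e / 3"
            using elim(1) by (simp only: dist_real_def divide_inverse_commute real_scaleR_def)
          then show ?thesis using q(2) by linarith
        qed
        finally have "(LINT t:{x..x+h}|lborel. norm (g t - g x)) / h < e" .
        moreover have "0 \<le> (LINT t:{x..x+h}|lborel. norm (g t - g x))"
          unfolding set_lebesgue_integral_def by (intro integral_nonneg_AE) auto
        ultimately show ?case using elim by simp
      qed
    qed
  qed
qed

section \<open>Fourier inversion\<close>

text \<open>The integral of \<open>e\<^bsup>-itx\<^esup>\<close> over \<open>[a, b]\<close>, in the closed form used by Levy's formula. The value at \<open>t = 0\<close> is \<open>0\<close> instead of the limit \<open>b - a\<close>, which affects
  a null set only.\<close>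

definition levy_kernel :: "real \<Rightarrow> real \<Rightarrow> real \<Rightarrow> complex" where
  "levy_kernel a b t = (iexp (-(t * a)) - iexp (-(t * b))) / (\<i> * t)"

text \<open>The transform in the normalisation of characteristic functions, the one in which Levy's
  inversion formula is stated.\<close>

definition char_fun :: "(real \<Rightarrow> complex) \<Rightarrow> real \<Rightarrow> complex" where
  "char_fun f t = (LINT x|lborel. f x * iexp (t * x))"

text \<open>Levy's formula for the complex measure with density \<open>f\<close>. The formula is known for probability
  measures, and both of its sides are linear in \<open>f\<close>.\<close>

definition levy_inverts :: "(real \<Rightarrow> complex) \<Rightarrow> bool" where
  "levy_inverts f \<longleftrightarrow> integrable lborel f \<and>
     (\<forall>a b. a \<le> b \<longrightarrow> (\<lambda>T::nat. 1 / (2 * pi) * (CLBINT t=-real T..real T. levy_kernel a b t * char_fun f t))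
        \<longlonglongrightarrow> (LINT x:{a<..b}|lborel. f x))"

lemma levy_kernel_measurable [measurable]: "levy_kernel a b \<in> borel_measurable borel"
  unfolding levy_kernel_def by measurable

lemma norm_levy_kernel_le: "a \<le> b \<Longrightarrow> norm (levy_kernel a b t) \<le> b - a"
  using Levy_Inversion_aux2[of "-b" "-a" t] by (cases "t = 0") (auto simp: levy_kernel_def)

lemma char_fun_measurable [measurable]:
  assumes [measurable]: "f \<in> borel_measurable borel"
  shows "char_fun f \<in> borel_measurable borel"
  unfolding char_fun_def by measurable

lemma integrable_mult_iexp:
  fixes f :: "real \<Rightarrow> complex"
  assumes "integrable lborel f"
  shows "integrable lborel (\<lambda>x. f x * iexp (t * x))"
proof (rule Bochner_Integration.integrable_bound[OF assms])
  have [measurable]: "f \<in> borel_measurable borel" using assms by auto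
  show "(\<lambda>x. f x * iexp (t * x)) \<in> borel_measurable lborel" by measurable
qed (simp add: norm_mult)

lemma norm_char_fun_le:
  "norm (char_fun f t) \<le> (LINT x|lborel. norm (f x))"
  unfolding char_fun_def
  by (rule order_trans[OF integral_norm_bound]) (simp add: norm_mult)

lemma levy_integrand_integrable:
  fixes T :: real
  assumes f: "integrable lborel f" and "a \<le> b"
  shows "interval_lebesgue_integrable lborel (-ereal T) T (\<lambda>t. levy_kernel a b t * char_fun f t)"
proof -
  have [measurable]: "f \<in> borel_measurable borel" using f by auto
  have "set_integrable lborel {-\<bar>T\<bar>..\<bar>T\<bar>} (\<lambda>t. levy_kernel a b t * char_fun f t)"
    unfolding set_integrable_def
  proof (rule integrableI_bounded_set_indicator[where B="(b - a) * (LINT x|lborel. norm (f x))"])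
    show "AE t in lborel. t \<in> {-\<bar>T\<bar>..\<bar>T\<bar>} \<longrightarrow> norm (levy_kernel a b t * char_fun f t) \<le> (b - a) * (LINT x|lborel. norm (f x))"
      using assms by (intro AE_I2 impI) (auto simp: norm_mult intro!: mult_mono norm_levy_kernel_le norm_char_fun_le)
  qed (auto simp: emeasure_lborel_Icc_eq)
  then show ?thesis
    unfolding interval_lebesgue_integrable_def
    by (auto elim!: set_integrable_subset)
qed

lemma levy_inverts_linear:
  assumes f: "levy_inverts f" and g: "levy_inverts g"
  shows "levy_inverts (\<lambda>x. f x + c * g x)"
  unfolding levy_inverts_def
proof (intro conjI allI impI)
  have int: "integrable lborel f" "integrable lborel g"
    using f g by (auto simp: levy_inverts_def)
  then show "integrable lborel (\<lambda>x. f x + c * g x)" by simp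
  fix a b :: real assume ab: "a \<le> b"
  have ch: "char_fun (\<lambda>x. f x + c * g x) t = char_fun f t + c * char_fun g t" for t
    using integrable_mult_iexp[OF int(1), of t] integrable_mult_iexp[OF int(2), of t]
    by (simp add: char_fun_def distrib_right mult.assoc)
  have eq: "(CLBINT t=-real T..real T. levy_kernel a b t * char_fun (\<lambda>x. f x + c * g x) t)
     = (CLBINT t=-real T..real T. levy_kernel a b t * char_fun f t)
       + c * (CLBINT t=-real T..real T. levy_kernel a b t * char_fun g t)" for T
  proof -
    have "(CLBINT t=-real T..real T. levy_kernel a b t * char_fun (\<lambda>x. f x + c * g x) t)
      = (CLBINT t=-real T..real T. levy_kernel a b t * char_fun f t + c * (levy_kernel a b t * char_fun g t))"
      by (simp add: ch algebra_simps)
    also have "\<dots> = (CLBINT t=-real T..real T. levy_kernel a b t * char_fun f t)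
       + (CLBINT t=-real T..real T. c * (levy_kernel a b t * char_fun g t))"
      using levy_integrand_integrable[OF int(1) ab, of "real T"] levy_integrand_integrable[OF int(2) ab, of "real T"]
      by (intro interval_lebesgue_integral_add(2)) auto
    finally show ?thesis by simp
  qed
  have "(LINT x:{a<..b}|lborel. f x + c * g x) = (LINT x:{a<..b}|lborel. f x) + c * (LINT x:{a<..b}|lborel. g x)"
    using int by (subst set_integral_add(2)) (auto simp: set_integrable_def intro!: integrable_mult_indicator)
  moreover have "(\<lambda>T::nat. 1 / (2 * pi) * (CLBINT t=-real T..real T. levy_kernel a b t * char_fun f t)
       + c * (1 / (2 * pi) * (CLBINT t=-real T..real T. levy_kernel a b t * char_fun g t)))
     \<longlonglongrightarrow> (LINT x:{a<..b}|lborel. f x) + c * (LINT x:{a<..b}|lborel. g x)"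
    using f g ab unfolding levy_inverts_def by (intro tendsto_intros) auto
  ultimately show "(\<lambda>T::nat. 1 / (2 * pi) * (CLBINT t=-real T..real T. levy_kernel a b t * char_fun (\<lambda>x. f x + c * g x) t))
        \<longlonglongrightarrow> (LINT x:{a<..b}|lborel. f x + c * g x)"
    unfolding eq by (simp add: algebra_simps)
qed

text \<open>A non-negative integrable function is a multiple of a probability density, and measures with a
  density have no atoms, so Levy's formula applies to every interval.\<close>

lemma levy_inverts_nonneg:
  fixes p :: "real \<Rightarrow> real"
  assumes p: "integrable lborel p" and nonneg: "\<And>x. 0 \<le> p x"
  shows "levy_inverts (\<lambda>x. complex_of_real (p x))"
proof -
  have [measurable]: "p \<in> borel_measurable borel" using p by auto
  define c where "c = (LINT x|lborel. p x)"
  show ?thesis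
  proof (cases "c = 0")
    case True
    then have ae: "AE x in lborel. p x = 0"
      using integral_nonneg_eq_0_iff_AE[OF p] nonneg by (simp add: c_def)
    have "char_fun (\<lambda>x. complex_of_real (p x)) = (\<lambda>t. 0)"
      unfolding char_fun_def using ae by (intro ext integral_eq_zero_AE) auto
    moreover have "(LINT x:{a<..b}|lborel. complex_of_real (p x)) = 0" for a b
      unfolding set_lebesgue_integral_def using ae by (intro integral_eq_zero_AE) auto
    ultimately show ?thesis using p by (simp add: levy_inverts_def)
  next
    case False
    then have c: "0 < c" using nonneg by (simp add: c_def less_le)
    define M where "M = density lborel (\<lambda>x. ennreal (p x / c))"
    have "(\<integral>\<^sup>+x. ennreal (p x / c) \<partial>lborel) = ennreal (LINT x|lborel. p x / c)"
      using p nonneg c by (intro nn_integral_eq_integral) auto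
    also have "(LINT x|lborel. p x / c) = 1" using c by (simp add: c_def)
    finally have "prob_space M"
      by (intro prob_spaceI) (simp add: M_def emeasure_density)
    then interpret M: real_distribution M
      by (simp add: real_distribution_def real_distribution_axioms_def M_def)
    have meas: "measure M A = (LINT x:A|lborel. p x) / c" if [measurable]: "A \<in> sets borel" for A
    proof -
      have "measure M A = (LINT x|M. indicator A x)" by (simp add: M_def)
      also have "\<dots> = (LINT x|lborel. (p x / c) *\<^sub>R indicator A x)"
        unfolding M_def using nonneg c by (intro integral_density) auto
      also have "\<dots> = (LINT x:A|lborel. p x) / c"
        unfolding set_lebesgue_integral_def by (simp add: mult.commute)
      finally show ?thesis .
    qed
    have single: "measure M {a} = 0" for a
    proof -
      have "(LINT x:{a}|lborel. p x) = 0"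
        unfolding set_lebesgue_integral_def
        using AE_lborel_singleton[of a] by (intro integral_eq_zero_AE) (auto elim!: eventually_mono)
      then show ?thesis by (simp add: meas)
    qed
    have ch: "char_fun (\<lambda>x. complex_of_real (p x)) t = c * char M t" for t
    proof -
      have "char M t = (LINT x|lborel. (p x / c) *\<^sub>R iexp (t * x))"
        unfolding char_def M_def using nonneg c by (intro integral_density) auto
      also have "\<dots> = (LINT x|lborel. complex_of_real (p x) * iexp (t * x)) / c"
        by (subst integral_divide_zero[symmetric]) (simp add: scaleR_conv_of_real)
      finally show ?thesis using c by (simp add: char_fun_def)
    qed
    show ?thesis
      unfolding levy_inverts_def
    proof (intro conjI allI impI)
      fix a b :: real assume ab: "a \<le> b"
      have "(\<lambda>T::nat. c * (1 / (2 * pi) * (CLBINT t=-real T..real T. levy_kernel a b t * char M t)))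
          \<longlonglongrightarrow> c * complex_of_real (measure M {a<..b})"
        using M.Levy_Inversion[OF ab single single] unfolding levy_kernel_def
        by (intro tendsto_mult tendsto_const) simp
      moreover have "c * complex_of_real (measure M {a<..b}) = (LINT x:{a<..b}|lborel. complex_of_real (p x))"
        using c by (simp add: meas set_integral_complex_of_real)
      moreover have "c * (1 / (2 * pi) * (CLBINT t=-real T..real T. levy_kernel a b t * char M t))
          = 1 / (2 * pi) * (CLBINT t=-real T..real T. levy_kernel a b t * char_fun (\<lambda>x. complex_of_real (p x)) t)" for T
        by (simp add: ch mult.left_commute)
      ultimately show "(\<lambda>T::nat. 1 / (2 * pi) * (CLBINT t=-real T..real T. levy_kernel a b t * char_fun (\<lambda>x. complex_of_real (p x)) t))
          \<longlonglongrightarrow> (LINT x:{a<..b}|lborel. complex_of_real (p x))"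
        by simp
    qed (use p in simp)
  qed
qed

lemma levy_inverts_integrable:
  assumes f: "integrable lborel f"
  shows "levy_inverts f"
proof -
  define P where "P u = levy_inverts (\<lambda>x. complex_of_real (max 0 (u (f x))))" for u :: "complex \<Rightarrow> real"
  have "P Re" "P (\<lambda>z. - Re z)" "P Im" "P (\<lambda>z. - Im z)"
    unfolding P_def using f
    by (auto intro!: levy_inverts_nonneg integrable_max)
  then have "levy_inverts (\<lambda>x. (complex_of_real (max 0 (Re (f x))) + (-1) * complex_of_real (max 0 (- Re (f x))))
      + \<i> * (complex_of_real (max 0 (Im (f x))) + (-1) * complex_of_real (max 0 (- Im (f x)))))"
    unfolding P_def by (intro levy_inverts_linear)
  also have "(\<lambda>x. (complex_of_real (max 0 (Re (f x))) + (-1) * complex_of_real (max 0 (- Re (f x))))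
      + \<i> * (complex_of_real (max 0 (Im (f x))) + (-1) * complex_of_real (max 0 (- Im (f x))))) = f"
    by (intro ext complex_eqI) (auto simp: max_def)
  finally show ?thesis .
qed

lemma levy_kernel_eq_integral:
  assumes "a \<le> b" "t \<noteq> 0"
  shows "levy_kernel a b t = (LINT x:{a..b}|lborel. iexp (-(t * x)))"
proof -
  have "((\<lambda>x. \<i> / t * iexp (-(t * x))) has_vector_derivative iexp (-(t * x))) (at x within {a..b})" for x
  proof -
    have "((\<lambda>z. \<i> / t * exp (\<i> * (- (t * z)))) has_field_derivative exp (\<i> * (- (t * x)))) (at (complex_of_real x))"
      using assms by (auto intro!: derivative_eq_intros)
    from has_vector_derivative_real_field[OF this] show ?thesis by simp
  qed
  then have "(LINT x|lborel. indicator {a..b} x *\<^sub>R iexp (-(t * x)))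
      = \<i> / t * iexp (-(t * b)) - \<i> / t * iexp (-(t * a))"
    using assms by (intro integral_FTC_Icc) (auto intro!: continuous_intros)
  also have "\<dots> = levy_kernel a b t"
    using assms by (simp add: levy_kernel_def field_simps)
  finally show ?thesis by (simp add: set_lebesgue_integral_def)
qed

text \<open>If the transform is integrable, the limit in Levy's formula becomes an integral over the line.
  Writing the kernel as an integral over \<open>[a, b]\<close> and exchanging the integrations shows that \<open>f\<close> and
  its inverse transform have the same integral over every interval.\<close>

lemma AE_eq_inverse_char_fun:
  assumes f: "integrable lborel f" and cf: "integrable lborel (char_fun f)"
  shows "AE x in lborel. f x = 1 / (2 * pi) * (LINT t|lborel. char_fun f t * iexp (-(t * x)))"
proof -
  define F where "F x = 1 / (2 * pi) * (LINT t|lborel. char_fun f t * iexp (-(t * x)))" for x :: real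
  have [measurable]: "f \<in> borel_measurable borel" using f by auto
  have [measurable]: "F \<in> borel_measurable borel" unfolding F_def by measurable
  have bound: "norm (F x) \<le> 1 / (2 * pi) * (LINT t|lborel. norm (char_fun f t))" for x
  proof -
    have "norm (LINT t|lborel. char_fun f t * iexp (-(t * x))) \<le> (LINT t|lborel. norm (char_fun f t))"
      by (rule order_trans[OF integral_norm_bound]) (simp add: norm_mult)
    then show ?thesis by (simp add: F_def norm_mult norm_divide divide_right_mono)
  qed
  have intF: "set_integrable lborel {a..b} F" for a b
    unfolding set_integrable_def
    by (rule integrableI_bounded_set_indicator[where B="1 / (2 * pi) * (LINT t|lborel. norm (char_fun f t))"])
       (use bound in \<open>auto simp: emeasure_lborel_Icc_eq\<close>)
  have intf: "set_integrable lborel A f" if "A \<in> sets borel" for A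
    unfolding set_integrable_def using f that by (intro integrable_mult_indicator) auto
  have eq: "(LINT x:{a..b}|lborel. f x) = (LINT x:{a..b}|lborel. F x)" if ab: "a \<le> b" for a b
  proof -
    have "(\<lambda>T::nat. 1 / (2 * pi) * (CLBINT t=-real T..real T. levy_kernel a b t * char_fun f t))
        \<longlonglongrightarrow> (LINT x:{a<..b}|lborel. f x)"
      using levy_inverts_integrable[OF f] ab by (auto simp: levy_inverts_def)
    moreover have "(\<lambda>T::nat. 1 / (2 * pi) * (CLBINT t=-real T..real T. levy_kernel a b t * char_fun f t))
        \<longlonglongrightarrow> 1 / (2 * pi) * (LINT t|lborel. levy_kernel a b t * char_fun f t)"
    proof (intro tendsto_mult tendsto_const)
      have "(\<lambda>T::nat. LINT t|lborel. indicator {-real T<..<real T} t *\<^sub>R (levy_kernel a b t * char_fun f t))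
        \<longlonglongrightarrow> (LINT t|lborel. levy_kernel a b t * char_fun f t)"
      proof (rule integral_dominated_convergence[where w="\<lambda>t. (b - a) * norm (char_fun f t)"])
        show "AE t in lborel. (\<lambda>T::nat. indicator {-real T<..<real T} t *\<^sub>R (levy_kernel a b t * char_fun f t))
            \<longlonglongrightarrow> levy_kernel a b t * char_fun f t"
        proof (intro AE_I2 tendsto_eventually)
          fix t :: real
          obtain n :: nat where n: "\<bar>t\<bar> < real n" using reals_Archimedean2 by blast
          show "\<forall>\<^sub>F T::nat in sequentially. indicator {-real T<..<real T} t *\<^sub>R (levy_kernel a b t * char_fun f t)
              = levy_kernel a b t * char_fun f t"
            using eventually_ge_at_top[of n]
          proof eventually_elim
            case (elim T)
            then have "real n \<le> real T" by simp
            then have "t \<in> {-real T<..<real T}" using n by auto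
            then show ?case by simp
          qed
        qed
        show "AE t in lborel. norm (indicator {-real T<..<real T} t *\<^sub>R (levy_kernel a b t * char_fun f t))
            \<le> (b - a) * norm (char_fun f t)" for T :: nat
          using ab norm_levy_kernel_le[OF ab]
          by (intro AE_I2) (auto simp: indicator_def norm_mult intro!: mult_right_mono)
      qed (use cf in auto)
      then show "(\<lambda>T::nat. CLBINT t=-real T..real T. levy_kernel a b t * char_fun f t)
        \<longlonglongrightarrow> (LINT t|lborel. levy_kernel a b t * char_fun f t)"
        by (simp add: interval_lebesgue_integral_def set_lebesgue_integral_def)
    qed
    ultimately have "(LINT x:{a<..b}|lborel. f x) = 1 / (2 * pi) * (LINT t|lborel. levy_kernel a b t * char_fun f t)"
      by (rule LIMSEQ_unique)
    also have "(LINT t|lborel. levy_kernel a b t * char_fun f t)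
        = (LINT t|lborel. LINT x|lborel. indicator {a..b} x *\<^sub>R (char_fun f t * iexp (-(t * x))))"
    proof (rule integral_cong_AE)
      show "AE t in lborel. levy_kernel a b t * char_fun f t
          = (LINT x|lborel. indicator {a..b} x *\<^sub>R (char_fun f t * iexp (-(t * x))))"
        using AE_lborel_singleton[of "0::real"]
      proof eventually_elim
        case (elim t)
        have "(LINT x|lborel. indicator {a..b} x *\<^sub>R (char_fun f t * iexp (-(t * x))))
          = (LINT x|lborel. char_fun f t * (indicator {a..b} x *\<^sub>R iexp (-(t * x))))"
          by (simp add: mult_ac)
        also have "\<dots> = char_fun f t * (LINT x|lborel. indicator {a..b} x *\<^sub>R iexp (-(t * x)))"
          by (rule integral_mult_right_zero)
        also have "\<dots> = char_fun f t * levy_kernel a b t"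
          by (simp only: levy_kernel_eq_integral[OF ab elim] set_lebesgue_integral_def)
        finally show ?case by simp
      qed
    qed measurable
    also have "\<dots> = (LINT x|lborel. LINT t|lborel. indicator {a..b} x *\<^sub>R (char_fun f t * iexp (-(t * x))))"
    proof (rule lborel_pair.Fubini_integral)
      show "integrable (lborel \<Otimes>\<^sub>M lborel)
          (\<lambda>(x, t). indicator {a..b} x *\<^sub>R (char_fun f t * iexp (-(t * x))))"
      proof (rule lborel_pair.Fubini_integrable)
        show "(\<lambda>(x, t). indicator {a..b} x *\<^sub>R (char_fun f t * iexp (-(t * x))))
            \<in> borel_measurable (lborel \<Otimes>\<^sub>M lborel)"
          by measurable
        have "(LINT t|lborel. norm (case (x, t) of (x, t) \<Rightarrow> indicator {a..b} x *\<^sub>R (char_fun f t * iexp (-(t * x)))))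
          = indicator {a..b} x *\<^sub>R (LINT t|lborel. norm (char_fun f t))" for x
          by (simp add: norm_mult)
        moreover have "integrable lborel (\<lambda>x::real. indicator {a..b} x *\<^sub>R (LINT t|lborel. norm (char_fun f t)))"
          by (intro integrable_scaleR_left) (simp add: emeasure_lborel_Icc_eq)
        ultimately show "integrable lborel (\<lambda>x. LINT t|lborel. norm (case (x, t) of (x, t) \<Rightarrow> indicator {a..b} x *\<^sub>R (char_fun f t * iexp (-(t * x)))))"
          by (simp only:)
        have "integrable lborel (\<lambda>t. char_fun f t * iexp (-(t * x)))" for x
          using integrable_mult_iexp[OF cf, of "-x"] by (simp add: mult.commute)
        then show "AE x in lborel. integrable lborel (\<lambda>t. case (x, t) of (x, t) \<Rightarrow> indicator {a..b} x *\<^sub>R (char_fun f t * iexp (-(t * x))))"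
          by simp
      qed
    qed
    also have "1 / (2 * pi) * \<dots> = (LINT x:{a..b}|lborel. F x)"
      by (simp add: set_lebesgue_integral_def F_def scaleR_conv_of_real mult_ac flip: integral_mult_right_zero)
    also have "(LINT x:{a<..b}|lborel. f x) = (LINT x:{a..b}|lborel. f x)"
      unfolding set_lebesgue_integral_def
      using AE_lborel_singleton[of a]
      by (intro integral_cong_AE) (auto elim!: eventually_mono simp: indicator_def)
    finally show ?thesis .
  qed
  have "AE x in lborel. f x - F x = 0"
    using eq intf intF by (intro AE_eq_0_of_interval_integrals set_integral_diff(1)) (auto simp: set_integral_diff(2))
  then show ?thesis unfolding F_def[symmetric] by simp
qed

text \<open>Functions here are only Lebesgue measurable, which is too little for product measurability of
  \<open>(x, t) \<mapsto> f(x - t)\<close>; Fubini-type arguments are carried out for a Borel version.\<close>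

lemma obtain_borel_version:
  fixes f :: "real \<Rightarrow> complex"
  assumes "f \<in> borel_measurable lebesgue"
  obtains g where "g \<in> borel_measurable borel" "AE x in lebesgue. f x = g x"
proof -
  have "(\<lambda>x. Re (f x)) \<in> borel_measurable lebesgue" "(\<lambda>x. Im (f x)) \<in> borel_measurable lebesgue"
    using assms by measurable
  from this[THEN completion_ex_borel_measurable_real] obtain u v
    where uv: "u \<in> borel_measurable lborel" "AE x in lborel. Re (f x) = u x"
      "v \<in> borel_measurable lborel" "AE x in lborel. Im (f x) = v x"
    by blast
  show ?thesis
  proof
    show "(\<lambda>x. Complex (u x) (v x)) \<in> borel_measurable borel"
      using uv(1,3) by (intro borel_measurable_complex_iff[THEN iffD2]) auto
    show "AE x in lebesgue. f x = Complex (u x) (v x)"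
      using uv(2,4) unfolding AE_completion_iff by eventually_elim (simp add: complex_eq_iff)
  qed
qed

lemma borel_measurable_id_lebesgue: "(\<lambda>x::real. x) \<in> borel_measurable lebesgue"
  by (simp add: measurable_completion)

lemma fourier_cong_AE:
  assumes "f \<in> borel_measurable lebesgue" "g \<in> borel_measurable lebesgue" "AE x in lebesgue. f x = g x"
  shows "fourier f = fourier g"
proof -
  note [measurable] = assms(1,2) borel_measurable_id_lebesgue
  show ?thesis
    unfolding fourier_def
  proof (intro ext integral_cong_AE)
    show "AE x in lebesgue. f x * exp (- 2 * of_real pi * \<i> * of_real (x * \<xi>))
        = g x * exp (- 2 * of_real pi * \<i> * of_real (x * \<xi>))" for \<xi>
      using assms(3) by eventually_elim simp
  qed measurable
qed

lemma fourier_eq_char_fun: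
  assumes [measurable]: "f \<in> borel_measurable borel"
  shows "fourier f \<xi> = char_fun f (- (2 * pi * \<xi>))"
proof -
  have "fourier f \<xi> = (LINT x|lborel. f x * exp (- 2 * of_real pi * \<i> * of_real (x * \<xi>)))"
    unfolding fourier_def by (intro integral_completion) measurable
  then show ?thesis by (simp add: char_fun_def mult_ac)
qed

lemma fourier_measurable [measurable]:
  assumes "f \<in> borel_measurable lebesgue"
  shows "fourier f \<in> borel_measurable borel"
proof -
  obtain g where g: "g \<in> borel_measurable borel" "AE x in lebesgue. f x = g x"
    using obtain_borel_version[OF assms] .
  have [measurable]: "char_fun g \<in> borel_measurable borel" using g by measurable
  have "fourier f = (\<lambda>\<xi>. char_fun g (- (2 * pi * \<xi>)))"
    using fourier_cong_AE[OF assms _ g(2)] fourier_eq_char_fun[OF g(1)] g(1) by (auto simp: measurable_completion)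
  then show ?thesis by simp
qed

theorem fourier_inversion:
  assumes f: "integrable lebesgue f" and ff: "integrable lebesgue (fourier f)"
  shows "AE x in lebesgue. f x = (LINT \<xi>|lebesgue. fourier f \<xi> * exp (2 * of_real pi * \<i> * of_real (\<xi> * x)))"
proof -
  have f_meas [measurable]: "f \<in> borel_measurable lebesgue" using f by auto
  obtain g where g [measurable]: "g \<in> borel_measurable borel" and fg: "AE x in lebesgue. f x = g x"
    using obtain_borel_version[of f] f by auto
  have gl: "g \<in> borel_measurable lebesgue" using g by (simp add: measurable_completion)
  have "integrable lebesgue g"
    using f integrable_cong_AE[OF f_meas gl fg] by simp
  then have int: "integrable lborel g" by (simp add: integrable_completion)
  have eq: "fourier f \<xi> = char_fun g (- (2 * pi * \<xi>))" for \<xi>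
    using fourier_cong_AE[OF f_meas gl fg] fourier_eq_char_fun[OF g] by simp
  have "integrable lborel (\<lambda>\<xi>. char_fun g (0 + (-(2 * pi)) * \<xi>))"
    using ff unfolding eq by (subst (asm) integrable_completion) auto
  then have "integrable lborel (char_fun g)"
    by (subst (asm) lborel_integrable_real_affine_iff) auto
  note inv = AE_eq_inverse_char_fun[OF int this]
  have "1 / (2 * pi) * (LINT t|lborel. char_fun g t * iexp (-(t * x)))
      = (LINT \<xi>|lebesgue. fourier f \<xi> * exp (2 * of_real pi * \<i> * of_real (\<xi> * x)))" for x
  proof -
    have "(LINT t|lborel. char_fun g t * iexp (-(t * x)))
        = (2 * pi) *\<^sub>R (LINT \<xi>|lborel. char_fun g (0 + (-(2 * pi)) * \<xi>) * iexp (-((0 + (-(2 * pi)) * \<xi>) * x)))"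
      by (subst lborel_integral_real_affine[where c="-(2 * pi)" and t=0]) auto
    also have "\<dots> = (2 * pi) *\<^sub>R (LINT \<xi>|lborel. fourier f \<xi> * exp (2 * of_real pi * \<i> * of_real (\<xi> * x)))"
      by (simp add: eq mult_ac)
    also have "(LINT \<xi>|lborel. fourier f \<xi> * exp (2 * of_real pi * \<i> * of_real (\<xi> * x)))
        = (LINT \<xi>|lebesgue. fourier f \<xi> * exp (2 * of_real pi * \<i> * of_real (\<xi> * x)))"
      by (intro integral_completion[symmetric]) measurable
    finally show ?thesis by (simp add: scaleR_conv_of_real)
  qed
  with inv have "AE x in lebesgue. g x = (LINT \<xi>|lebesgue. fourier f \<xi> * exp (2 * of_real pi * \<i> * of_real (\<xi> * x)))"
    unfolding AE_completion_iff by simp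
  with fg show ?thesis by eventually_elim simp
qed

lemma norm_fourier_le: "norm (fourier f \<xi>) \<le> (LINT x|lebesgue. norm (f x))"
  unfolding fourier_def
  by (rule order_trans[OF integral_norm_bound]) (simp add: norm_mult)

lemma bandlimited_fourier_integrable:
  assumes "f \<in> bandlimited"
  shows "integrable lebesgue (fourier f)"
proof -
  define K where "K = closure {\<xi>. fourier f \<xi> \<noteq> 0}"
  have f: "integrable lebesgue f" and K: "compact K" using assms by (auto simp: bandlimited_def K_def)
  then have [measurable]: "f \<in> borel_measurable lebesgue" by auto
  have "integrable lborel (\<lambda>\<xi>. indicator K \<xi> *\<^sub>R fourier f \<xi>)"
    using K emeasure_compact_finite[OF K] norm_fourier_le[of f]
    by (intro integrableI_bounded_set_indicator[where B="LINT x|lebesgue. norm (f x)"])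
       (auto simp: borel_compact)
  moreover have "indicator K \<xi> *\<^sub>R fourier f \<xi> = fourier f \<xi>" for \<xi>
    using closure_subset[of "{\<xi>. fourier f \<xi> \<noteq> 0}"] by (auto simp: K_def indicator_def)
  ultimately show ?thesis by (simp add: integrable_completion)
qed

section \<open>The constant multiplier\<close>

text \<open>With a constant multiplier the double integral is the product of the inverse transforms of
  \<open>fourier f\<close> and \<open>fourier g\<close>.\<close>

lemma bilinear_mult_one:
  assumes f: "f \<in> bandlimited" and g: "g \<in> bandlimited"
  shows "AE x in lebesgue. bilinear_mult (\<lambda>x. 1) f g x = f x * g x"
proof -
  define inv where "inv h x = (LINT \<xi>|lebesgue. fourier h \<xi> * exp (2 * of_real pi * \<i> * of_real (\<xi> * x)))"
    for h :: "real \<Rightarrow> complex" and x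
  have "bilinear_mult (\<lambda>x. 1) f g x = inv f x * inv g x" for x
  proof -
    have "bilinear_mult (\<lambda>x. 1) f g x =
      (LINT \<eta>|lebesgue. fourier g \<eta> * exp (2 * of_real pi * \<i> * of_real (\<eta> * x)) * inv f x)"
      unfolding bilinear_mult_def inv_def
      by (intro Bochner_Integration.integral_cong refl, subst integral_mult_right_zero[symmetric])
         (simp add: distrib_right distrib_left exp_add mult_ac)
    then show ?thesis by (simp add: inv_def)
  qed
  moreover have "AE x in lebesgue. f x = inv f x" "AE x in lebesgue. g x = inv g x"
    unfolding inv_def
    using fourier_inversion[OF _ bandlimited_fourier_integrable[OF f]]
      fourier_inversion[OF _ bandlimited_fourier_integrable[OF g]] f g
    by (simp_all add: bandlimited_def)
  ultimately show ?thesis by auto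
qed

lemma one_in_multiplier_space:
  assumes \<Phi>: "young_function \<Phi>1" "young_function \<Phi>2" "young_function \<Phi>3"
    and K: "0 < K" "\<And>y. 0 < y \<Longrightarrow> yinv \<Phi>1 y * yinv \<Phi>2 y \<le> K * yinv \<Phi>3 y"
  shows "(\<lambda>x. 1) \<in> multiplier_space \<Phi>1 \<Phi>2 \<Phi>3"
  unfolding multiplier_space_def
proof (intro CollectI conjI exI ballI)
  show "locally_integrable (\<lambda>x. 1)"
    unfolding locally_integrable_def set_integrable_def
  proof (intro allI impI)
    fix S :: "real set" assume "compact S"
    then have "emeasure lborel S < \<infinity>" "S \<in> sets borel" by (rule emeasure_compact_finite borel_compact)+
    then show "complex_integrable lebesgue (\<lambda>x. indicator S x *\<^sub>R 1)"
      by (simp add: integrable_completion)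
  qed
  show "0 < 4 * K" using K by simp
  fix f g assume fg: "f \<in> bandlimited" "g \<in> bandlimited"
  then have "f \<in> borel_measurable lebesgue" "g \<in> borel_measurable lebesgue" by (auto simp: bandlimited_def)
  then show "luxemburg_norm \<Phi>3 (bilinear_mult (\<lambda>x. 1) f g)
      \<le> ennreal (4 * K) * luxemburg_norm \<Phi>1 f * luxemburg_norm \<Phi>2 g"
    using luxemburg_prod_le[OF \<Phi> K] luxemburg_cong_AE[OF bilinear_mult_one[OF fg]] by simp
qed

section \<open>The Fejer kernel\<close>

text \<open>A continuous, compactly supported probability density; it is the Fourier transform of the Fejer
  kernel.\<close>

definition tent :: "real \<Rightarrow> real" where
  "tent \<xi> = max 0 (1 - \<bar>\<xi>\<bar>)"

definition fejer :: "real \<Rightarrow> complex" where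
  "fejer x = (LINT \<xi>|lborel. tent \<xi> * iexp (2 * pi * \<xi> * x))"

lemma tent_measurable [measurable]: "tent \<in> borel_measurable borel"
  unfolding tent_def by measurable

lemma tent_nonneg [simp]: "0 \<le> tent \<xi>"
  and tent_le_1: "tent \<xi> \<le> 1"
  and tent_eq_0: "1 \<le> \<bar>\<xi>\<bar> \<Longrightarrow> tent \<xi> = 0"
  by (auto simp: tent_def)

lemma tent_has_integral:
  "has_bochner_integral lborel tent 1"
proof -
  have 1: "has_bochner_integral lborel (\<lambda>x. indicator {-1..0} x *\<^sub>R (1 + x)) (0 + 0^2 / 2 - ((-1) + (-1)^2 / 2 :: real))"
    by (intro has_bochner_integral_FTC_Icc[where F="\<lambda>x. x + x^2 / 2"])
      (auto intro!: derivative_eq_intros continuous_intros simp: has_real_derivative_iff_has_vector_derivative[symmetric])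
  have 2: "has_bochner_integral lborel (\<lambda>x. indicator {0..1} x *\<^sub>R (1 - x)) (1 - 1^2 / 2 - (0 - 0^2 / 2 :: real))"
    by (intro has_bochner_integral_FTC_Icc[where F="\<lambda>x. x - x^2 / 2"])
      (auto intro!: derivative_eq_intros continuous_intros simp: has_real_derivative_iff_has_vector_derivative[symmetric])
  have "has_bochner_integral lborel tent (0 + 0^2 / 2 - ((-1) + (-1)^2 / 2) + (1 - 1^2 / 2 - (0 - 0^2 / 2)))"
  proof (rule has_bochner_integralI_AE[OF has_bochner_integral_add[OF 1 2]])
    show "AE x in lborel. indicator {-1..0} x *\<^sub>R (1 + x) + indicator {0..1} x *\<^sub>R (1 - x) = tent x"
      using AE_lborel_singleton[of "0::real"]
      by eventually_elim (auto simp: tent_def indicator_def)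
  qed measurable
  then show ?thesis by simp
qed

lemma tent_integrable [simp]: "integrable lborel tent"
  and tent_integral: "(LINT \<xi>|lborel. tent \<xi>) = 1"
  using tent_has_integral by (auto simp: has_bochner_integral_iff)

lemma fejer_eq_char_fun: "fejer x = char_fun tent (2 * pi * x)"
  by (simp add: fejer_def char_fun_def mult_ac)

lemma fejer_measurable [measurable]: "fejer \<in> borel_measurable borel"
  unfolding fejer_def by measurable

lemma norm_fejer_le_1: "norm (fejer x) \<le> 1"
  using norm_char_fun_le[of tent "2 * pi * x"] by (simp add: fejer_eq_char_fun tent_integral)

lemma norm_fejer_diff_1_le: "norm (fejer x - 1) \<le> 2 * pi * \<bar>x\<bar>"
proof -
  have int: "integrable lborel (\<lambda>\<xi>. tent \<xi> * iexp (2 * pi * \<xi> * x))"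
    using integrable_mult_iexp[of tent "2 * pi * x"] by (simp add: mult_ac)
  have "fejer x - 1 = (LINT \<xi>|lborel. tent \<xi> * iexp (2 * pi * \<xi> * x) - complex_of_real (tent \<xi>))"
    using int by (subst Bochner_Integration.integral_diff) (auto simp: fejer_def tent_integral)
  also have "norm \<dots> \<le> (LINT \<xi>|lborel. tent \<xi> * (2 * pi * \<bar>x\<bar>))"
  proof (rule Bochner_Integration.integral_norm_bound_integral)
    fix \<xi>
    show "norm (tent \<xi> * iexp (2 * pi * \<xi> * x) - complex_of_real (tent \<xi>)) \<le> tent \<xi> * (2 * pi * \<bar>x\<bar>)"
    proof (cases "\<bar>\<xi>\<bar> \<le> 1")
      case True
      have "norm (tent \<xi> * iexp (2 * pi * \<xi> * x) - complex_of_real (tent \<xi>))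
          = tent \<xi> * norm (iexp (2 * pi * \<xi> * x) - 1)"
      proof -
        have "tent \<xi> * iexp (2 * pi * \<xi> * x) - complex_of_real (tent \<xi>)
            = complex_of_real (tent \<xi>) * (iexp (2 * pi * \<xi> * x) - 1)"
          by (simp add: right_diff_distrib)
        then show ?thesis by (simp only: norm_mult) simp
      qed
      also have "norm (iexp (2 * pi * \<xi> * x) - 1) \<le> 2 * pi * \<bar>x\<bar> * \<bar>\<xi>\<bar>"
        using iexp_approx1[of "2 * pi * \<xi> * x" 0] by (simp add: abs_mult mult_ac)
      also have "\<dots> \<le> 2 * pi * \<bar>x\<bar> * 1"
        using True by (intro mult_left_mono) auto
      finally show ?thesis by (simp add: mult_left_mono)
    qed (simp add: tent_eq_0)
  qed (use int in auto)
  also have "\<dots> = 2 * pi * \<bar>x\<bar>" by (simp add: tent_integral)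
  finally show ?thesis .
qed

lemma norm_fejer_ge_half:
  assumes "\<bar>x\<bar> \<le> 1/16"
  shows "1/2 \<le> norm (fejer x)"
proof -
  have "norm (fejer x - 1) \<le> 2 * 4 * (1/16)"
    using pi_less_4 assms by (intro order_trans[OF norm_fejer_diff_1_le] mult_mono) auto
  then show ?thesis
    using norm_triangle_ineq2[of 1 "1 - fejer x"] by (simp add: norm_minus_commute)
qed

text \<open>The quadratic decay that makes the Fejer kernel integrable. Integrating by parts on both halves
  of the tent gives \<open>w\<^sup>2 F(x) = e\<^sup>w + e\<^bsup>-w\<^esup> - 2\<close> with \<open>w = 2 \<pi> i x\<close>; the boundary terms of first order
  cancel because the tent is continuous.\<close>

lemma norm_fejer_decay: "(2 * pi * x)\<^sup>2 * norm (fejer x) \<le> 4"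
proof (cases "x = 0")
  case False
  define w where "w = \<i> * (2 * pi * x)"
  have w: "w \<noteq> 0" "norm w = 2 * pi * \<bar>x\<bar>" using False by (auto simp: w_def norm_mult)
  define G1 where "G1 z = (1 + z) * exp (w * z) / w - exp (w * z) / w\<^sup>2" for z
  define G2 where "G2 z = (1 - z) * exp (w * z) / w + exp (w * z) / w\<^sup>2" for z
  have "((\<lambda>\<xi>. G1 (of_real \<xi>)) has_vector_derivative ((1 + of_real \<xi>) * exp (w * of_real \<xi>))) (at \<xi> within S)" for \<xi> S
  proof (rule has_vector_derivative_real_field)
    show "(G1 has_field_derivative ((1 + of_real \<xi>) * exp (w * of_real \<xi>))) (at (of_real \<xi>))"
      unfolding G1_def using w
      by (auto intro!: derivative_eq_intros simp: field_simps power2_eq_square)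
  qed
  then have 1: "has_bochner_integral lborel (\<lambda>\<xi>. indicator {-1..0} \<xi> *\<^sub>R ((1 + of_real \<xi>) * exp (w * of_real \<xi>)))
      (G1 (of_real 0) - G1 (of_real (-1)))"
    by (intro has_bochner_integral_FTC_Icc[where F="\<lambda>\<xi>. G1 (of_real \<xi>)"]) (auto intro!: continuous_intros)
  have "((\<lambda>\<xi>. G2 (of_real \<xi>)) has_vector_derivative ((1 - of_real \<xi>) * exp (w * of_real \<xi>))) (at \<xi> within S)" for \<xi> S
  proof (rule has_vector_derivative_real_field)
    show "(G2 has_field_derivative ((1 - of_real \<xi>) * exp (w * of_real \<xi>))) (at (of_real \<xi>))"
      unfolding G2_def using w
      by (auto intro!: derivative_eq_intros simp: field_simps power2_eq_square)
  qed
  then have 2: "has_bochner_integral lborel (\<lambda>\<xi>. indicator {0..1} \<xi> *\<^sub>R ((1 - of_real \<xi>) * exp (w * of_real \<xi>)))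
      (G2 (of_real 1) - G2 (of_real 0))"
    by (intro has_bochner_integral_FTC_Icc[where F="\<lambda>\<xi>. G2 (of_real \<xi>)"]) (auto intro!: continuous_intros)
  have "has_bochner_integral lborel (\<lambda>\<xi>. tent \<xi> * iexp (2 * pi * \<xi> * x))
      (G1 (of_real 0) - G1 (of_real (-1)) + (G2 (of_real 1) - G2 (of_real 0)))"
  proof (rule has_bochner_integralI_AE[OF has_bochner_integral_add[OF 1 2]])
    show "AE \<xi> in lborel. indicator {-1..0} \<xi> *\<^sub>R ((1 + of_real \<xi>) * exp (w * of_real \<xi>))
       + indicator {0..1} \<xi> *\<^sub>R ((1 - of_real \<xi>) * exp (w * of_real \<xi>)) = tent \<xi> * iexp (2 * pi * \<xi> * x)"
      using AE_lborel_singleton[of "0::real"]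
      by eventually_elim (auto simp: tent_def indicator_def w_def mult_ac)
  qed measurable
  then have "fejer x = G1 (of_real 0) - G1 (of_real (-1)) + (G2 (of_real 1) - G2 (of_real 0))"
    unfolding fejer_def by (rule has_bochner_integral_integral_eq)
  also have "\<dots> = (exp w + exp (- w) - 2) / w\<^sup>2"
    using w by (simp add: G1_def G2_def field_simps power2_eq_square)
  finally have "w\<^sup>2 * fejer x = exp w + exp (- w) - 2" using w by simp
  then have "norm (w\<^sup>2 * fejer x) = norm (exp w + exp (- w) - 2)" by simp
  also have "\<dots> \<le> norm (exp w) + norm (exp (- w)) + 2"
    by (intro order_trans[OF norm_triangle_ineq4] add_mono norm_triangle_ineq) auto
  also have "\<dots> = 4" by (simp add: w_def)
  finally show ?thesis using w by (simp add: norm_mult norm_power power_mult_distrib)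
qed simp

lemma fejer_integrable: "integrable lborel fejer"
proof (rule Bochner_Integration.integrable_bound)
  show "integrable lborel (\<lambda>x::real. 5 * inverse (1 + x^2))"
    using integrable_inverse_1_plus_square by (simp add: set_integrable_def einterval_def)
  show "AE x in lborel. norm (fejer x) \<le> norm (5 * inverse (1 + x\<^sup>2))"
  proof (rule AE_I2)
    fix x :: real
    have "1 * x\<^sup>2 \<le> (2 * pi)\<^sup>2 * x\<^sup>2"
      using one_le_power[of "2 * pi" 2] pi_gt3 by (intro mult_right_mono) auto
    then have "(1 + x\<^sup>2) * norm (fejer x) \<le> (1 + (2 * pi * x)\<^sup>2) * norm (fejer x)"
      by (intro mult_right_mono) (auto simp: power_mult_distrib)
    also have "\<dots> \<le> 5"
      using norm_fejer_decay[of x] norm_fejer_le_1[of x] by (simp add: distrib_right)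
    finally show "norm (fejer x) \<le> norm (5 * inverse (1 + x\<^sup>2))"
      by (simp add: field_simps add_pos_nonneg)
  qed
qed measurable

lemma fourier_continuous:
  assumes "integrable lborel f"
  shows "continuous_on UNIV (fourier f)"
proof -
  have [measurable]: "f \<in> borel_measurable borel" using assms by auto
  have "isCont (char_fun f) t" for t
    unfolding continuous_at_sequentially comp_def char_fun_def
  proof safe
    fix u :: "nat \<Rightarrow> real" assume u: "u \<longlonglongrightarrow> t"
    show "(\<lambda>n. LINT x|lborel. f x * iexp (u n * x)) \<longlonglongrightarrow> (LINT x|lborel. f x * iexp (t * x))"
      by (rule integral_dominated_convergence[where w="\<lambda>x. norm (f x)"])
         (use assms u in \<open>auto intro!: tendsto_intros simp: norm_mult\<close>)
  qed
  then have "continuous_on UNIV (char_fun f)" by (simp add: continuous_on_eq_continuous_at)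
  then have "continuous_on UNIV (\<lambda>\<xi>. char_fun f (- (2 * pi * \<xi>)))"
    by (rule continuous_on_compose2) (auto intro!: continuous_intros)
  then show ?thesis by (simp add: fourier_eq_char_fun cong: continuous_on_cong)
qed

text \<open>Inversion gives the identity almost everywhere; both sides are continuous, so the set where they
  differ is open and null, hence empty. Equality everywhere is needed since the support of the
  transform has to be compact.\<close>

lemma fourier_fejer: "fourier fejer \<xi> = tent \<xi>"
proof -
  have cf: "char_fun tent (0 + 2 * pi * s) = fejer s" for s
    by (simp add: fejer_eq_char_fun)
  have "integrable lborel (\<lambda>s. char_fun tent (0 + 2 * pi * s))"
    unfolding cf by (rule fejer_integrable)
  then have int: "integrable lborel (char_fun tent)"
    by (subst (asm) lborel_integrable_real_affine_iff) auto
  have "AE x in lborel. complex_of_real (tent x) = 1 / (2 * pi) * (LINT t|lborel. char_fun tent t * iexp (-(t * x)))"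
    by (rule AE_eq_inverse_char_fun) (simp_all add: int)
  moreover have "1 / (2 * pi) * (LINT t|lborel. char_fun tent t * iexp (-(t * x))) = fourier fejer x" for x
  proof -
    have "(LINT t|lborel. char_fun tent t * iexp (-(t * x)))
      = (2 * pi) *\<^sub>R (LINT s|lborel. char_fun tent (0 + 2 * pi * s) * iexp (-((0 + 2 * pi * s) * x)))"
      by (subst lborel_integral_real_affine[where c="2 * pi" and t=0]) auto
    also have "\<dots> = (2 * pi) *\<^sub>R fourier fejer x"
      unfolding cf unfolding fourier_eq_char_fun[OF fejer_measurable] char_fun_def by (simp add: mult_ac)
    finally show ?thesis by (simp add: scaleR_conv_of_real)
  qed
  ultimately have ae: "AE x in lborel. complex_of_real (tent x) = fourier fejer x" by simp
  define S where "S = {x. complex_of_real (tent x) \<noteq> fourier fejer x}"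
  have "open S"
    unfolding S_def tent_def using fourier_continuous[OF fejer_integrable]
    by (intro open_Collect_neq continuous_intros)
  moreover have "negligible S"
    unfolding negligible_iff_null_sets completion.null_sets_iff_AE using ae
    by (simp add: S_def AE_completion_iff)
  ultimately have "S = {}" using open_not_negligible by blast
  then show ?thesis by (auto simp: S_def)
qed

section \<open>Modulated and dilated Fejer kernels as test functions\<close>

text \<open>A Fejer kernel spread over length \<open>1 / r\<close> whose frequencies lie in \<open>[\<theta> - r, \<theta> + r]\<close>.\<close>

definition wave :: "real \<Rightarrow> real \<Rightarrow> real \<Rightarrow> complex" where
  "wave \<theta> r x = iexp (2 * pi * \<theta> * x) * fejer (r * x)"

lemma wave_measurable [measurable]: "wave \<theta> r \<in> borel_measurable borel"
  unfolding wave_def by measurable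

lemma norm_wave: "norm (wave \<theta> r x) = norm (fejer (r * x))"
  by (simp add: wave_def norm_mult)

lemma wave_integrable:
  assumes "0 < r"
  shows "integrable lborel (wave \<theta> r)"
proof (rule Bochner_Integration.integrable_bound)
  show "integrable lborel (\<lambda>x. fejer (0 + r * x))"
    using assms by (intro lborel_integrable_real_affine fejer_integrable) auto
qed (auto simp: norm_wave)

lemma fourier_wave:
  assumes r: "0 < r"
  shows "fourier (wave \<theta> r) \<xi> = complex_of_real (tent ((\<xi> - \<theta>) / r) / r)"
proof -
  have "fourier (wave \<theta> r) \<xi> = (LINT x|lborel. wave \<theta> r x * iexp (- (2 * pi * \<xi>) * x))"
    by (simp add: fourier_eq_char_fun char_fun_def)
  also have "\<dots> = (1 / r) *\<^sub>R (LINT s|lborel. wave \<theta> r (0 + 1 / r * s) * iexp (- (2 * pi * \<xi>) * (0 + 1 / r * s)))"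
    using r by (subst lborel_integral_real_affine[where c="1 / r" and t=0]) auto
  also have "(LINT s|lborel. wave \<theta> r (0 + 1 / r * s) * iexp (- (2 * pi * \<xi>) * (0 + 1 / r * s)))
     = (LINT s|lborel. fejer s * iexp (- (2 * pi * ((\<xi> - \<theta>) / r)) * s))"
  proof (rule Bochner_Integration.integral_cong[OF refl])
    fix s
    have "iexp (2 * pi * \<theta> * (1 / r * s)) * iexp (- (2 * pi * \<xi>) * (1 / r * s))
        = iexp (- (2 * pi * ((\<xi> - \<theta>) / r)) * s)"
      using r unfolding exp_add[symmetric] by (intro arg_cong[where f=exp]) (simp add: field_simps)
    then show "wave \<theta> r (0 + 1 / r * s) * iexp (- (2 * pi * \<xi>) * (0 + 1 / r * s))
        = fejer s * iexp (- (2 * pi * ((\<xi> - \<theta>) / r)) * s)"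
      using r by (simp add: wave_def mult_ac)
  qed
  also have "\<dots> = fourier fejer ((\<xi> - \<theta>) / r)"
    by (simp add: fourier_eq_char_fun char_fun_def)
  finally show ?thesis by (simp add: fourier_fejer scaleR_conv_of_real)
qed

text \<open>The inverse transform of the dilated tent, straight from the definition of the Fejer kernel by a
  change of variables.\<close>

lemma wave_eq_integral:
  assumes r: "0 < r"
  shows "(LINT \<xi>|lborel. complex_of_real (tent ((\<xi> - \<theta>) / r) / r) * iexp (2 * pi * \<xi> * x)) = wave \<theta> r x"
proof -
  have "(LINT \<xi>|lborel. complex_of_real (tent ((\<xi> - \<theta>) / r) / r) * iexp (2 * pi * \<xi> * x))
      = r *\<^sub>R (LINT s|lborel. complex_of_real (tent ((\<theta> + r * s - \<theta>) / r) / r) * iexp (2 * pi * (\<theta> + r * s) * x))"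
    using r by (subst lborel_integral_real_affine[where c=r and t=\<theta>]) auto
  also have "\<dots> = (LINT s|lborel. iexp (2 * pi * \<theta> * x) * (tent s * iexp (2 * pi * s * (r * x))))"
    unfolding integral_scaleR_right[symmetric]
  proof (rule Bochner_Integration.integral_cong[OF refl])
    fix s
    have "iexp (2 * pi * (\<theta> + r * s) * x) = iexp (2 * pi * \<theta> * x) * iexp (2 * pi * s * (r * x))"
      unfolding exp_add[symmetric] by (intro arg_cong[where f=exp]) (simp add: algebra_simps)
    then show "r *\<^sub>R (complex_of_real (tent ((\<theta> + r * s - \<theta>) / r) / r) * iexp (2 * pi * (\<theta> + r * s) * x))
      = iexp (2 * pi * \<theta> * x) * (tent s * iexp (2 * pi * s * (r * x)))"
      using r by (simp add: scaleR_conv_of_real)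
  qed
  finally show ?thesis by (simp add: wave_def fejer_def)
qed

lemma wave_bandlimited:
  assumes r: "0 < r"
  shows "wave \<theta> r \<in> bandlimited"
proof -
  have "{\<xi>. fourier (wave \<theta> r) \<xi> \<noteq> 0} \<subseteq> {\<theta> - r..\<theta> + r}"
  proof clarify
    fix \<xi> assume "fourier (wave \<theta> r) \<xi> \<noteq> 0"
    then have "\<not> 1 \<le> \<bar>(\<xi> - \<theta>) / r\<bar>"
      using r by (auto simp: fourier_wave tent_eq_0)
    then show "\<xi> \<in> {\<theta> - r..\<theta> + r}"
      using r by (auto simp: field_simps abs_if split: if_splits)
  qed
  then have "bounded {\<xi>. fourier (wave \<theta> r) \<xi> \<noteq> 0}"
    by (rule bounded_subset[OF bounded_closed_interval])
  then show ?thesis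
    using wave_integrable[OF r, of \<theta>] by (simp add: bandlimited_def integrable_completion compact_closure)
qed

text \<open>Since \<open>\<bar>F\<bar> \<le> 1\<close>, convexity gives \<open>\<Phi>(\<bar>F\<bar> z) \<le> \<bar>F\<bar> \<Phi>(z)\<close>, so the modular of the dilated kernel is at
  most \<open>\<Phi>(z) A / r\<close>, exactly as for the indicator of an interval of length \<open>A / r\<close>. The value
  \<open>z = \<Phi>\<inverse>(r / A) / 2\<close> makes this at most \<open>1\<close>.\<close>

lemma luxemburg_wave_le:
  assumes \<Phi>: "young_function \<Phi>" and r: "0 < r"
    and A: "0 < A" "(LINT x|lborel. norm (fejer x)) \<le> A"
  shows "luxemburg_norm \<Phi> (wave \<theta> r) \<le> ennreal (2 / yinv \<Phi> (r / A))"
proof (rule luxemburg_leI)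
  define p where "p = yinv \<Phi> (r / A)"
  have p: "0 < p" unfolding p_def using yinv_pos[OF \<Phi>] r A by simp
  then show "0 < 2 / yinv \<Phi> (r / A)" by (simp add: p_def)
  have small: "\<Phi> (p / 2) \<le> ennreal (r / A)"
    using p by (intro le_of_less_yinv[OF \<Phi>]) (auto simp: p_def[symmetric])
  have int: "integrable lborel (\<lambda>x. norm (fejer (0 + r * x)))"
    using r by (intro integrable_norm lborel_integrable_real_affine fejer_integrable) auto
  have "(\<integral>\<^sup>+ x. \<Phi> (norm (wave \<theta> r x) / (2 / p)) \<partial>lebesgue)
      \<le> (\<integral>\<^sup>+ x. ennreal (norm (fejer (0 + r * x))) * \<Phi> (p / 2) \<partial>lebesgue)"
  proof (rule nn_integral_mono)
    fix x
    show "\<Phi> (norm (wave \<theta> r x) / (2 / p)) \<le> ennreal (norm (fejer (0 + r * x))) * \<Phi> (p / 2)"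
      using young_scale[OF \<Phi>, of "norm (fejer (r * x))" "p / 2"] norm_fejer_le_1[of "r * x"]
      by (simp add: norm_wave)
  qed
  also have "\<dots> = (\<integral>\<^sup>+ x. ennreal (norm (fejer (0 + r * x))) \<partial>lborel) * \<Phi> (p / 2)"
    by (subst nn_integral_completion, subst nn_integral_multc) auto
  also have "(\<integral>\<^sup>+ x. ennreal (norm (fejer (0 + r * x))) \<partial>lborel) = ennreal (LINT x|lborel. norm (fejer (0 + r * x)))"
    using int by (intro nn_integral_eq_integral) auto
  also have "(LINT x|lborel. norm (fejer (0 + r * x))) = (LINT x|lborel. norm (fejer x)) / r"
    using r by (subst lborel_integral_real_affine[where c=r and t=0]) auto
  also have "ennreal ((LINT x|lborel. norm (fejer x)) / r) * \<Phi> (p / 2) \<le> ennreal (A / r) * ennreal (r / A)"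
    using A r small by (intro mult_mono ennreal_leI divide_right_mono) auto
  also have "\<dots> = 1"
    using A r by (subst ennreal_mult[symmetric]) auto
  finally show "(\<integral>\<^sup>+ x. \<Phi> (norm (wave \<theta> r x) / (2 / yinv \<Phi> (r / A))) \<partial>lebesgue) \<le> 1"
    by (simp add: p_def)
qed

section \<open>Multipliers near a Lebesgue point\<close>

lemma tent_scaled_integral:
  assumes r: "0 < r"
  shows "integrable lborel (\<lambda>\<xi>. tent ((\<xi> - \<theta>) / r) / r)" "(LINT \<xi>|lborel. tent ((\<xi> - \<theta>) / r) / r) = 1"
proof -
  have *: "tent ((\<xi> - \<theta>) / r) = tent (- \<theta> / r + 1 / r * \<xi>)" for \<xi>
    by (simp add: diff_divide_distrib)
  have "integrable lborel (\<lambda>\<xi>. tent (- \<theta> / r + 1 / r * \<xi>))"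
    using r by (intro lborel_integrable_real_affine) auto
  then show "integrable lborel (\<lambda>\<xi>. tent ((\<xi> - \<theta>) / r) / r)" by (simp add: *)
  have "1 = \<bar>1 / r\<bar> *\<^sub>R (LINT \<xi>|lborel. tent (- \<theta> / r + 1 / r * \<xi>))"
    using r by (subst lborel_integral_real_affine[symmetric]) (auto simp: tent_integral)
  then show "(LINT \<xi>|lborel. tent ((\<xi> - \<theta>) / r) / r) = 1"
    using r by (simp add: *)
qed

text \<open>The frequency windows are \<open>[\<tau> + r, \<tau> + 3r]\<close> and \<open>[-r, r]\<close>, so their differences fill
  \<open>[\<tau>, \<tau> + 4r]\<close>. Replacing \<open>M\<close> by the constant \<open>m\<close> there produces \<open>m f g\<close>. In the error the first
  tent has height \<open>1 / r\<close>, the second one has integral \<open>1\<close>, and what is left is the integral of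
  \<open>\<bar>M - m\<bar>\<close> over \<open>[\<tau>, \<tau> + 4r]\<close>.\<close>

lemma bilinear_wave_approx:
  fixes M :: "real \<Rightarrow> complex"
  assumes r: "0 < r" and M [measurable]: "M \<in> borel_measurable borel"
    and int: "set_integrable lborel {\<tau>..\<tau> + 4 * r} (\<lambda>t. M t - m)"
  shows "norm (bilinear_mult M (wave (\<tau> + 2 * r) r) (wave 0 r) x - m * wave (\<tau> + 2 * r) r x * wave 0 r x)
           \<le> (LINT t:{\<tau>..\<tau> + 4 * r}|lborel. norm (M t - m)) / r"
proof -
  define a where "a \<xi> = complex_of_real (tent ((\<xi> - (\<tau> + 2 * r)) / r) / r)" for \<xi>
  define b where "b \<eta> = complex_of_real (tent ((\<eta> - 0) / r) / r)" for \<eta>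
  define E where "E \<xi> = iexp (2 * pi * \<xi> * x)" for \<xi>
  define D where "D u = indicator {\<tau>..\<tau> + 4 * r} u *\<^sub>R (M u - m)" for u
  define R where "R \<eta> = (LINT \<xi>|lborel. a \<xi> * E \<xi> * D (\<xi> - \<eta>))" for \<eta>
  define L where "L = (LINT t:{\<tau>..\<tau> + 4 * r}|lborel. norm (M t - m))"
  have [measurable]: "a \<in> borel_measurable borel" "b \<in> borel_measurable borel" "E \<in> borel_measurable borel"
      "D \<in> borel_measurable borel"
    unfolding a_def b_def E_def D_def by measurable
  have [measurable]: "R \<in> borel_measurable borel" unfolding R_def by measurable
  have intD: "integrable lborel D" using int by (simp add: D_def[abs_def] set_integrable_def)
  have LD: "(LINT u|lborel. norm (D u)) = L"
    by (simp add: L_def D_def set_lebesgue_integral_def)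
  have L0: "0 \<le> L" unfolding LD[symmetric] by simp
  have a_le: "norm (a \<xi>) \<le> 1 / r" for \<xi>
    using r tent_le_1 by (auto simp: a_def norm_divide intro!: divide_right_mono)
  have [simp]: "norm (E \<xi>) = 1" for \<xi> by (simp add: E_def)
  have inta: "integrable lborel (\<lambda>\<xi>. a \<xi> * E \<xi>)" and intb: "integrable lborel (\<lambda>\<eta>. b \<eta> * E \<eta>)"
    and b1: "integrable lborel (\<lambda>\<eta>. norm (b \<eta>))" "(LINT \<eta>|lborel. norm (b \<eta>)) = 1"
  proof -
    have "integrable lborel a" "integrable lborel b"
      unfolding a_def b_def by (rule integrable_of_real tent_scaled_integral(1)[OF r])+
    then show "integrable lborel (\<lambda>\<xi>. a \<xi> * E \<xi>)" "integrable lborel (\<lambda>\<eta>. b \<eta> * E \<eta>)" "integrable lborel (\<lambda>\<eta>. norm (b \<eta>))"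
      using integrable_mult_iexp[of a "2 * pi * x"] integrable_mult_iexp[of b "2 * pi * x"]
      by (auto simp: E_def mult_ac)
    have "norm (b \<eta>) = tent ((\<eta> - 0) / r) / r" for \<eta> using r by (simp add: b_def norm_divide)
    then show "(LINT \<eta>|lborel. norm (b \<eta>)) = 1" using tent_scaled_integral(2)[OF r, of 0] by simp
  qed
  have intD': "integrable lborel (\<lambda>\<xi>. D (\<xi> - \<eta>))" "(LINT \<xi>|lborel. norm (D (\<xi> - \<eta>))) = L" for \<eta>
    using lborel_integrable_real_affine[OF intD, of 1 "- \<eta>"]
      lborel_integral_real_affine[of 1 "\<lambda>u. norm (D u)" "- \<eta>"] LD by simp_all
  have intaD: "integrable lborel (\<lambda>\<xi>. a \<xi> * E \<xi> * D (\<xi> - \<eta>))" for \<eta>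
  proof (rule Bochner_Integration.integrable_bound)
    show "integrable lborel (\<lambda>\<xi>. 1 / r * norm (D (\<xi> - \<eta>)))" using intD' by auto
    show "AE \<xi> in lborel. norm (a \<xi> * E \<xi> * D (\<xi> - \<eta>)) \<le> norm (1 / r * norm (D (\<xi> - \<eta>)))"
      using mult_right_mono[OF a_le norm_ge_zero] r by (auto simp: norm_mult)
  qed measurable
  have R_le: "norm (R \<eta>) \<le> L / r" for \<eta>
  proof -
    have "norm (R \<eta>) \<le> (LINT \<xi>|lborel. 1 / r * norm (D (\<xi> - \<eta>)))"
      unfolding R_def using mult_right_mono[OF a_le norm_ge_zero]
      by (intro Bochner_Integration.integral_norm_bound_integral intaD) (use intD' in \<open>auto simp: norm_mult\<close>)
    then show ?thesis using intD' by simp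
  qed
  have inner: "(LINT \<xi>|lborel. a \<xi> * b \<eta> * M (\<xi> - \<eta>) * (E \<xi> * E \<eta>))
     = m * wave (\<tau> + 2 * r) r x * (b \<eta> * E \<eta>) + b \<eta> * E \<eta> * R \<eta>" for \<eta>
  proof -
    have "a \<xi> * b \<eta> * M (\<xi> - \<eta>) * (E \<xi> * E \<eta>)
        = m * (b \<eta> * E \<eta>) * (a \<xi> * E \<xi>) + b \<eta> * E \<eta> * (a \<xi> * E \<xi> * D (\<xi> - \<eta>))" for \<xi>
    proof (cases "a \<xi> * b \<eta> = 0")
      case False
      then have "\<bar>(\<xi> - (\<tau> + 2 * r)) / r\<bar> < 1" "\<bar>\<eta> / r\<bar> < 1"
        using r tent_eq_0 unfolding a_def b_def by (auto simp: not_le[symmetric])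
      then have "\<bar>\<xi> - (\<tau> + 2 * r)\<bar> < r" "\<bar>\<eta>\<bar> < r" using r by (simp_all add: abs_divide)
      then have "\<xi> - \<eta> \<in> {\<tau>..\<tau> + 4 * r}" by auto
      then show ?thesis by (simp add: D_def algebra_simps)
    qed auto
    then have "(LINT \<xi>|lborel. a \<xi> * b \<eta> * M (\<xi> - \<eta>) * (E \<xi> * E \<eta>))
       = (LINT \<xi>|lborel. m * (b \<eta> * E \<eta>) * (a \<xi> * E \<xi>) + b \<eta> * E \<eta> * (a \<xi> * E \<xi> * D (\<xi> - \<eta>)))"
      by (simp only:)
    also have "\<dots> = m * (b \<eta> * E \<eta>) * (LINT \<xi>|lborel. a \<xi> * E \<xi>) + b \<eta> * E \<eta> * R \<eta>"
      unfolding R_def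
      by (subst Bochner_Integration.integral_add)
         (simp_all only: integrable_mult_right[OF inta] integrable_mult_right[OF intaD] integral_mult_right_zero)
    also have "(LINT \<xi>|lborel. a \<xi> * E \<xi>) = wave (\<tau> + 2 * r) r x"
      unfolding a_def E_def by (rule wave_eq_integral[OF r])
    finally show ?thesis by (simp add: mult_ac)
  qed
  have exp_eq: "exp (2 * of_real pi * \<i> * of_real ((\<xi> + \<eta>) * x)) = E \<xi> * E \<eta>" for \<xi> \<eta>
    unfolding E_def exp_add[symmetric] by (intro arg_cong[where f=exp]) (simp add: algebra_simps)
  have "bilinear_mult M (wave (\<tau> + 2 * r) r) (wave 0 r) x
      = (LINT \<eta>|lebesgue. LINT \<xi>|lebesgue. a \<xi> * b \<eta> * M (\<xi> - \<eta>) * (E \<xi> * E \<eta>))"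
    unfolding bilinear_mult_def fourier_wave[OF r] a_def b_def exp_eq ..
  also have "\<dots> = (LINT \<eta>|lebesgue. LINT \<xi>|lborel. a \<xi> * b \<eta> * M (\<xi> - \<eta>) * (E \<xi> * E \<eta>))"
    by (intro Bochner_Integration.integral_cong refl integral_completion) measurable
  also have "\<dots> = (LINT \<eta>|lborel. m * wave (\<tau> + 2 * r) r x * (b \<eta> * E \<eta>) + b \<eta> * E \<eta> * R \<eta>)"
    unfolding inner by (intro integral_completion) measurable
  also have "\<dots> = m * wave (\<tau> + 2 * r) r x * (LINT \<eta>|lborel. b \<eta> * E \<eta>) + (LINT \<eta>|lborel. b \<eta> * E \<eta> * R \<eta>)"
  proof (subst Bochner_Integration.integral_add)
    show "integrable lborel (\<lambda>\<eta>. b \<eta> * E \<eta> * R \<eta>)"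
    proof (rule Bochner_Integration.integrable_bound)
      show "integrable lborel (\<lambda>\<eta>. L / r * norm (b \<eta>))" using b1 by (intro integrable_mult_right)
      have "norm (b \<eta> * E \<eta> * R \<eta>) \<le> norm (L / r * norm (b \<eta>))" for \<eta>
      proof -
        have "norm (b \<eta> * E \<eta> * R \<eta>) = norm (R \<eta>) * norm (b \<eta>)"
          by (simp add: norm_mult)
        also have "\<dots> \<le> \<bar>L / r\<bar> * norm (b \<eta>)"
          by (intro mult_right_mono order_trans[OF R_le abs_ge_self] norm_ge_zero)
        finally show ?thesis by (simp only: real_norm_def abs_mult abs_norm_cancel)
      qed
      then show "AE \<eta> in lborel. norm (b \<eta> * E \<eta> * R \<eta>) \<le> norm (L / r * norm (b \<eta>))"
        by simp
    qed measurable
  qed (simp_all only: integrable_mult_right[OF intb] integral_mult_right_zero)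
  also have "(LINT \<eta>|lborel. b \<eta> * E \<eta>) = wave 0 r x"
    unfolding b_def E_def by (rule wave_eq_integral[OF r])
  finally have "norm (bilinear_mult M (wave (\<tau> + 2 * r) r) (wave 0 r) x - m * wave (\<tau> + 2 * r) r x * wave 0 r x)
      = norm (LINT \<eta>|lborel. b \<eta> * E \<eta> * R \<eta>)" by simp
  also have "\<dots> \<le> (LINT \<eta>|lborel. norm (b \<eta> * E \<eta> * R \<eta>))" by (rule integral_norm_bound)
  also have "\<dots> \<le> (LINT \<eta>|lborel. L / r * norm (b \<eta>))"
  proof (rule integral_mono')
    show "norm (b \<eta> * E \<eta> * R \<eta>) \<le> L / r * norm (b \<eta>)" for \<eta>
      using mult_right_mono[OF R_le norm_ge_zero, of \<eta> "b \<eta>"] by (simp add: norm_mult mult.commute)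
  qed (use b1 r L0 in auto)
  also have "\<dots> = L / r" by (simp only: integral_mult_right_zero b1 mult_1_right)
  finally show ?thesis by (simp add: L_def)
qed

lemma bilinear_mult_cong_AE:
  assumes M: "M \<in> borel_measurable lebesgue" and M': "M' \<in> borel_measurable borel"
    and ae: "AE x in lebesgue. M x = M' x"
    and f: "f \<in> borel_measurable lebesgue"
  shows "bilinear_mult M f g = bilinear_mult M' f g"
proof -
  have ae': "AE \<xi> in lebesgue. M (\<xi> - \<eta>) = M' (\<xi> - \<eta>)" for \<eta>
  proof -
    obtain N where N: "N \<in> null_sets lborel" "{x. M x \<noteq> M' x} \<subseteq> N"
      using ae[unfolded AE_completion_iff] unfolding eventually_ae_filter by auto
    then have "AE x in lborel. x \<notin> N" by (intro AE_not_in)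
    then have "AE \<xi> in lborel. - \<eta> + 1 * \<xi> \<notin> N"
      using N(1) by (intro AE_borel_affine) auto
    then show ?thesis unfolding AE_completion_iff
      by eventually_elim (use N(2) in auto)
  qed
  have [measurable]: "(\<lambda>\<xi>. M (\<xi> - \<eta>)) \<in> borel_measurable lebesgue" for \<eta>
  proof -
    have "(\<lambda>x::real. - \<eta> + (\<Sum>j\<in>Basis. (1 * (x \<bullet> j)) *\<^sub>R j)) \<in> lebesgue \<rightarrow>\<^sub>M lebesgue"
      by (rule lebesgue_affine_measurable) auto
    then show ?thesis using measurable_compose[OF _ M, of "\<lambda>\<xi>. \<xi> - \<eta>" lebesgue] by simp
  qed
  have [measurable]: "(\<lambda>\<xi>. M' (\<xi> - \<eta>)) \<in> borel_measurable lebesgue" for \<eta>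
    using M' by (intro measurable_completion) simp
  have "(LINT \<xi>|lebesgue. fourier f \<xi> * fourier g \<eta> * M (\<xi> - \<eta>) * exp (2 * of_real pi * \<i> * of_real ((\<xi> + \<eta>) * x)))
     = (LINT \<xi>|lebesgue. fourier f \<xi> * fourier g \<eta> * M' (\<xi> - \<eta>) * exp (2 * of_real pi * \<i> * of_real ((\<xi> + \<eta>) * x)))" for \<eta> x
  proof (intro integral_cong_AE)
    note [measurable] = borel_measurable_id_lebesgue
    have [measurable]: "fourier f \<in> borel_measurable lebesgue"
      using fourier_measurable[OF f] by (simp add: measurable_completion)
    show "(\<lambda>\<xi>. fourier f \<xi> * fourier g \<eta> * M (\<xi> - \<eta>) * exp (2 * of_real pi * \<i> * of_real ((\<xi> + \<eta>) * x))) \<in> borel_measurable lebesgue"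
      "(\<lambda>\<xi>. fourier f \<xi> * fourier g \<eta> * M' (\<xi> - \<eta>) * exp (2 * of_real pi * \<i> * of_real ((\<xi> + \<eta>) * x))) \<in> borel_measurable lebesgue"
      by measurable
    show "AE \<xi> in lebesgue. fourier f \<xi> * fourier g \<eta> * M (\<xi> - \<eta>) * exp (2 * of_real pi * \<i> * of_real ((\<xi> + \<eta>) * x))
        = fourier f \<xi> * fourier g \<eta> * M' (\<xi> - \<eta>) * exp (2 * of_real pi * \<i> * of_real ((\<xi> + \<eta>) * x))"
      using ae'[of \<eta>] by eventually_elim simp
  qed
  then show ?thesis by (simp add: bilinear_mult_def fun_eq_iff)
qed

text \<open>The blow-up at a Lebesgue point. The threshold \<open>\<bar>m\<bar> / 32\<close> for the averages over \<open>[\<tau>, \<tau> + h]\<close> with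
  \<open>h = 4 r\<close> keeps the error below \<open>\<bar>m\<bar> / 8\<close>, half of the lower bound \<open>\<bar>m\<bar> / 4\<close> for \<open>\<bar>m f g\<bar>\<close> on
  \<open>\<bar>x\<bar> \<le> 1 / (16 r)\<close>.\<close>

lemma yinv_bound_of_nontrivial_multiplier:
  assumes \<Phi>: "young_function \<Phi>1" "young_function \<Phi>2" "young_function \<Phi>3"
    and M: "M \<in> multiplier_space \<Phi>1 \<Phi>2 \<Phi>3" and nontriv: "\<not> (AE x in lebesgue. M x = 0)"
  obtains K y0 where "0 < y0" "\<And>y. 0 < y \<Longrightarrow> y < y0 \<Longrightarrow> yinv \<Phi>1 y * yinv \<Phi>2 y \<le> K * yinv \<Phi>3 y"
proof -
  have li: "locally_integrable M" using M by (simp add: multiplier_space_def)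
  obtain C where C: "0 < C" "\<And>f g. f \<in> bandlimited \<Longrightarrow> g \<in> bandlimited \<Longrightarrow>
      luxemburg_norm \<Phi>3 (bilinear_mult M f g) \<le> ennreal C * luxemburg_norm \<Phi>1 f * luxemburg_norm \<Phi>2 g"
    using M by (auto simp: multiplier_space_def)
  have setint: "set_integrable lebesgue {a..b} M" for a b
    using li compact_Icc by (auto simp: locally_integrable_def)
  have M_meas: "M \<in> borel_measurable lebesgue"
  proof (rule borel_measurable_LIMSEQ_metric)
    show "(\<lambda>x. indicator {-real n..real n} x *\<^sub>R M x) \<in> borel_measurable lebesgue" for n :: nat
      using setint[of "-real n" "real n"] by (auto simp: set_integrable_def)
    fix x :: real
    obtain n :: nat where n: "\<bar>x\<bar> \<le> real n" using real_arch_simple by blast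
    show "(\<lambda>n. indicator {-real n..real n} x *\<^sub>R M x) \<longlonglongrightarrow> M x"
    proof (rule tendsto_eventually, rule eventually_mono[OF eventually_ge_at_top[of n]])
      fix k assume "n \<le> k"
      then have "real n \<le> real k" by simp
      then have "x \<in> {-real k..real k}" using n by auto
      then show "indicator {-real k..real k} x *\<^sub>R M x = M x" by simp
    qed
  qed
  obtain M' where M' [measurable]: "M' \<in> borel_measurable borel" and MM': "AE x in lebesgue. M x = M' x"
    using obtain_borel_version[OF M_meas] .
  have setint': "set_integrable lborel {a..b} M'" for a b
  proof -
    have "integrable lebesgue (\<lambda>x. indicator {a..b} x *\<^sub>R M' x)"
    proof (rule integrable_cong_AE_imp)
      show "integrable lebesgue (\<lambda>x. indicator {a..b} x *\<^sub>R M x)"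
        using setint by (simp add: set_integrable_def)
      show "(\<lambda>x. indicator {a..b} x *\<^sub>R M' x) \<in> borel_measurable lebesgue"
        by (intro measurable_completion) measurable
      show "AE x in lebesgue. indicator {a..b} x *\<^sub>R M x = indicator {a..b} x *\<^sub>R M' x"
        using MM' by eventually_elim simp
    qed
    then show ?thesis by (subst (asm) integrable_completion) (auto simp: set_integrable_def)
  qed
  have "\<not> (AE x in lborel. M' x = 0)"
  proof
    assume "AE x in lborel. M' x = 0"
    then have "AE x in lebesgue. M' x = 0" by (simp add: AE_completion_iff)
    with MM' have "AE x in lebesgue. M x = 0" by eventually_elim simp
    with nontriv show False by simp
  qed
  moreover note AE_right_Lebesgue_point[OF setint']
  ultimately obtain \<tau> where \<tau>: "M' \<tau> \<noteq> 0"
    and lim: "((\<lambda>h. (LINT t:{\<tau>..\<tau>+h}|lborel. norm (M' t - M' \<tau>)) / h) \<longlongrightarrow> 0) (at_right 0)"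
    by (metis (mono_tags, lifting) eventually_mono)
  define m where "m = M' \<tau>"
  have "\<forall>\<^sub>F h in at_right 0. (LINT t:{\<tau>..\<tau>+h}|lborel. norm (M' t - m)) / h < norm m / 32"
    using lim \<tau> unfolding m_def by (intro order_tendstoD(2)) auto
  then obtain h0 where h0: "0 < h0" "\<And>h. 0 < h \<Longrightarrow> h < h0 \<Longrightarrow>
      (LINT t:{\<tau>..\<tau>+h}|lborel. norm (M' t - m)) / h < norm m / 32"
    unfolding eventually_at_right_field by auto
  \<comment> \<open>the maximum with \<open>1\<close> makes \<open>8 A \<ge> 1\<close>, as required by \<open>yinv_scale\<close>\<close>
  define A where "A = max 1 (LINT x|lborel. norm (fejer x))"
  have A: "1 \<le> A" "(LINT x|lborel. norm (fejer x)) \<le> A" by (auto simp: A_def)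
  define c where "c = norm m / 8"
  have c: "0 < c" using \<tau> by (simp add: c_def m_def)
  have key: "yinv \<Phi>1 y * yinv \<Phi>2 y \<le> 4 * C / c * (8 * A) * yinv \<Phi>3 y" if y: "0 < y" "y < h0 / (4 * A)" for y
  proof -
    \<comment> \<open>the dilation for which the norms of the test functions are governed by the argument \<open>y\<close>\<close>
    define r where "r = A * y"
    have r: "0 < r" "4 * r < h0" "r / A = y" using y A by (auto simp: r_def field_simps)
    define f where "f = wave (\<tau> + 2 * r) r"
    define g where "g = wave 0 r"
    have fg: "f \<in> bandlimited" "g \<in> bandlimited" using r by (auto simp: f_def g_def wave_bandlimited)
    have "c \<le> norm (bilinear_mult M f g x)" if x: "\<bar>x\<bar> \<le> 1 / (16 * r)" for x
    proof -
      have "\<bar>r * x\<bar> \<le> 1 / 16" using x r by (simp add: abs_mult field_simps)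
      then have half: "1/2 \<le> norm (f x)" "1/2 \<le> norm (g x)"
        unfolding f_def g_def norm_wave by (rule norm_fejer_ge_half)+
      have "norm m * (1/2 * (1/2)) \<le> norm m * (norm (f x) * norm (g x))"
        using half by (intro mult_left_mono mult_mono) auto
      then have big: "2 * c \<le> norm (m * f x * g x)" by (simp add: c_def norm_mult mult.assoc)
      have "norm (bilinear_mult M' f g x - m * f x * g x) \<le> (LINT t:{\<tau>..\<tau> + 4 * r}|lborel. norm (M' t - m)) / r"
        unfolding f_def g_def
        by (intro bilinear_wave_approx r(1) M' set_integral_diff(1) setint'
            borel_integrable_atLeastAtMost'[OF continuous_on_const])
      also have "\<dots> \<le> c"
        using h0(2)[of "4 * r"] r by (simp add: c_def field_simps)
      finally have "c \<le> norm (bilinear_mult M' f g x)"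
        using big norm_triangle_ineq2[of "m * f x * g x" "bilinear_mult M' f g x"]
        by (simp add: norm_minus_commute)
      then show ?thesis
        using bilinear_mult_cong_AE[OF M_meas M' MM', of f g] by (simp add: f_def measurable_completion)
    qed
    then have "ennreal (c / yinv \<Phi>3 (1 / (2 * (1 / (16 * r))))) \<le> luxemburg_norm \<Phi>3 (bilinear_mult M f g)"
      using r c by (intro luxemburg_ge_of_bound[OF \<Phi>(3)]) auto
    also have "\<dots> \<le> ennreal C * luxemburg_norm \<Phi>1 f * luxemburg_norm \<Phi>2 g" by (rule C(2)[OF fg])
    also have "\<dots> \<le> ennreal C * ennreal (2 / yinv \<Phi>1 (r / A)) * ennreal (2 / yinv \<Phi>2 (r / A))"
      unfolding f_def g_def using A r by (intro mult_mono luxemburg_wave_le \<Phi>) auto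
    also have "\<dots> = ennreal (C * (2 / yinv \<Phi>1 y) * (2 / yinv \<Phi>2 y))"
    proof -
      have "ennreal C * ennreal u * ennreal v = ennreal (C * u * v)" if "0 \<le> u" "0 \<le> v" for u v
        using C(1) that by (simp add: ennreal_mult)
      then show ?thesis unfolding r(3) by simp
    qed
    finally have le: "c / yinv \<Phi>3 (8 * r) \<le> C * (2 / yinv \<Phi>1 y) * (2 / yinv \<Phi>2 y)"
      using C by (subst (asm) ennreal_le_iff) auto
    have pos: "0 < yinv \<Phi>1 y" "0 < yinv \<Phi>2 y" "0 < yinv \<Phi>3 (8 * r)"
      using y r by (auto intro: yinv_pos \<Phi>)
    have "yinv \<Phi>1 y * yinv \<Phi>2 y \<le> 4 * C / c * yinv \<Phi>3 (8 * A * y)"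
      using le pos c by (simp add: field_simps r_def)
    also have "\<dots> \<le> 4 * C / c * (8 * A * yinv \<Phi>3 y)"
      using A y C c by (intro mult_left_mono yinv_scale[OF \<Phi>(3)]) auto
    finally show ?thesis by (simp add: mult_ac)
  qed
  show ?thesis
    by (rule that[of "h0 / (4 * A)", OF _ key]) (use h0 A in auto)
qed

section \<open>Non-triviality of the multiplier space\<close>

theorem theorem5p2:
  fixes \<Phi>1 \<Phi>2 \<Phi>3 :: "real \<Rightarrow> ennreal"
  assumes "young_function \<Phi>1" and "young_function \<Phi>2" and "young_function \<Phi>3"
  shows "((SUP x\<in>{0<..}. young_inv \<Phi>1 x * young_inv \<Phi>2 x / young_inv \<Phi>3 x) < \<infinity>
            \<longrightarrow> \<not> trivial_ae (multiplier_space \<Phi>1 \<Phi>2 \<Phi>3)) \<and>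
         (\<not> trivial_ae (multiplier_space \<Phi>1 \<Phi>2 \<Phi>3) \<longrightarrow>
            (\<forall>a::real. 0 < a \<longrightarrow>
               (SUP N\<in>{1::nat..}. young_inv \<Phi>1 (1 / (real N * a)) * young_inv \<Phi>2 (1 / (real N * a))
                  / young_inv \<Phi>3 (1 / (real N * a))) < \<infinity>))"
proof (intro conjI impI allI)
  define S where "S = (SUP x\<in>{0<..}. young_inv \<Phi>1 x * young_inv \<Phi>2 x / young_inv \<Phi>3 x)"
  assume "(SUP x\<in>{0<..}. young_inv \<Phi>1 x * young_inv \<Phi>2 x / young_inv \<Phi>3 x) < \<infinity>"
  then have S: "S = ennreal (enn2real S)" by (simp add: S_def)
  have "yinv \<Phi>1 y * yinv \<Phi>2 y \<le> (enn2real S + 1) * yinv \<Phi>3 y" if y: "0 < y" for y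
  proof -
    have "young_inv \<Phi>1 y * young_inv \<Phi>2 y / young_inv \<Phi>3 y \<le> S"
      unfolding S_def using y by (intro SUP_upper) simp
    then have "ennreal (yinv \<Phi>1 y * yinv \<Phi>2 y / yinv \<Phi>3 y) \<le> ennreal (enn2real S)"
      using S young_inv_ratio[OF assms y] by simp
    then have "yinv \<Phi>1 y * yinv \<Phi>2 y / yinv \<Phi>3 y \<le> enn2real S + 1"
      by (subst (asm) ennreal_le_iff) auto
    then show ?thesis using yinv_pos[OF assms(3) y] by (simp add: field_simps)
  qed
  then have one: "(\<lambda>x. 1) \<in> multiplier_space \<Phi>1 \<Phi>2 \<Phi>3"
    by (intro one_in_multiplier_space[OF assms, of "enn2real S + 1"]) (auto simp: add_nonneg_pos)
  show "\<not> trivial_ae (multiplier_space \<Phi>1 \<Phi>2 \<Phi>3)"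
  proof
    assume "trivial_ae (multiplier_space \<Phi>1 \<Phi>2 \<Phi>3)"
    from this[unfolded trivial_ae_def, rule_format, OF one]
    have "AE x::real in lebesgue. (1::complex) = 0" .
    then show False by (simp add: eventually_False ae_filter_eq_bot_iff)
  qed
next
  fix a :: real
  assume nt: "\<not> trivial_ae (multiplier_space \<Phi>1 \<Phi>2 \<Phi>3)" and a: "0 < a"
  then obtain M where "M \<in> multiplier_space \<Phi>1 \<Phi>2 \<Phi>3" "\<not> (AE x in lebesgue. M x = 0)"
    unfolding trivial_ae_def by blast
  then obtain K y0 where y0: "0 < y0"
    and K: "\<And>y. 0 < y \<Longrightarrow> y < y0 \<Longrightarrow> yinv \<Phi>1 y * yinv \<Phi>2 y \<le> K * yinv \<Phi>3 y"
    using yinv_bound_of_nontrivial_multiplier[OF assms] by metis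
  \<comment> \<open>for \<open>y0 \<le> y \<le> 1 / a\<close> the numerator is largest at \<open>1 / a\<close> and the denominator smallest at \<open>y0\<close>\<close>
  define K' where "K' = max K (yinv \<Phi>1 (1 / a) * yinv \<Phi>2 (1 / a) / yinv \<Phi>3 y0)"
  have "young_inv \<Phi>1 (1 / (real N * a)) * young_inv \<Phi>2 (1 / (real N * a)) / young_inv \<Phi>3 (1 / (real N * a)) \<le> ennreal K'"
    if N: "1 \<le> N" for N :: nat
  proof -
    define y where "y = 1 / (real N * a)"
    have y: "0 < y" "y \<le> 1 / a" using N a by (auto simp: y_def field_simps)
    have "yinv \<Phi>1 y * yinv \<Phi>2 y / yinv \<Phi>3 y \<le> K'"
    proof (cases "y < y0")
      case True
      have "yinv \<Phi>1 y * yinv \<Phi>2 y / yinv \<Phi>3 y \<le> K"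
        using K[OF y(1) True] yinv_pos[OF assms(3) y(1)] by (simp add: field_simps)
      then show ?thesis by (simp add: K'_def)
    next
      case False
      have "yinv \<Phi>1 y * yinv \<Phi>2 y / yinv \<Phi>3 y \<le> yinv \<Phi>1 (1 / a) * yinv \<Phi>2 (1 / a) / yinv \<Phi>3 y0"
        using y y0 False assms
        by (intro frac_le mult_mono yinv_mono mult_nonneg_nonneg yinv_pos) auto
      then show ?thesis by (simp add: K'_def)
    qed
    then show ?thesis
      unfolding y_def[symmetric] young_inv_ratio[OF assms y(1)] by (rule ennreal_leI)
  qed
  then have "(SUP N\<in>{1::nat..}. young_inv \<Phi>1 (1 / (real N * a)) * young_inv \<Phi>2 (1 / (real N * a))
                  / young_inv \<Phi>3 (1 / (real N * a))) \<le> ennreal K'"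
    by (intro SUP_least) auto
  also have "\<dots> < \<infinity>" by simp
  finally show "(SUP N\<in>{1::nat..}. young_inv \<Phi>1 (1 / (real N * a)) * young_inv \<Phi>2 (1 / (real N * a))
                  / young_inv \<Phi>3 (1 / (real N * a))) < \<infinity>" .
qed

end
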